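(* For generic $u \in U$, the Heisenberg invariant quartic surface $\mathcal{X}_u$ contains at least $320$ smooth conics.
   Context: Work over $\mathbb{C}$, with homogeneous coordinates $(x,y,z,w)$ on $\mathbb{P}^3$. Let $g_0 = x^4+y^4+z^4+w^4$, $g_1 = 2(x^2y^2+z^2w^2)$, $g_2 = 2(x^2z^2+y^2w^2)$, $g_3 = 2(x^2w^2+y^2z^2)$, $g_4 = 4xyzw$. Let $U = \{u_0+u_1+u_2+u_3+u_4+u_5=0\} \subset \mathbb{P}^5$, so $U \cong \mathbb{P}^4$. For $u=(u_0,\dots,u_5) \in U$ put $A=-u_4-u_5$, $B=-u_0-u_1+u_2+u_3$, $C=-u_0+u_1-u_2+u_3$, $D=-u_0+u_1+u_2-u_3$, $E=2u_4-2u_5$ (this identifies $U$ with the $\mathbb{P}^4$ with coordinates $(A,B,C,D,E)$), and let $\mathcal{X}_u \subset \mathbb{P}^3$ be the quartic surface $Ag_0+Bg_1+Cg_2+Dg_3+Eg_4=0$. A Heisenberg invariant quartic (or invariant quartic) is a surface $\mathcal{X}_u$ for some $u \in U$. "Generic $u$" means all $u$ in some non-empty Zariski open subset of $U$. *)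

theory Defs
  imports "HOL-Analysis.Analysis"
begin

text \<open>Points of the complex projective space with homogeneous coordinates indexed by
  \<open>'n\<close> (so of dimension \<open>CARD('n) - 1\<close>) are the lines through the origin of \<open>complex ^ 'n\<close>.
  The finite types \<open>4\<close> and \<open>6\<close> have the elements \<open>0, ..., 3\<close> and \<open>0, ..., 5\<close>.\<close>

definition proj_space :: "(complex ^ 'n) set set" where
  "proj_space = {vec.span {v} | v. v \<noteq> 0}"

text \<open>Homogeneous polynomials are represented by the functions they induce, which is harmless
  over the infinite field of complex numbers. The sum runs over all exponent vectors of total
  degree \<open>d\<close>; there are finitely many of them.\<close>

definition form :: "nat \<Rightarrow> (complex ^ 'n \<Rightarrow> complex) \<Rightarrow> bool" where
  "form d f \<longleftrightarrow> (\<exists>c :: ('n \<Rightarrow> nat) \<Rightarrow> complex.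
     f = (\<lambda>v. \<Sum>m | (\<Sum>i\<in>UNIV. m i) = d. c m * (\<Prod>i\<in>UNIV. v $ i ^ m i)))"

lemma finite_exponents: "finite {m :: 'n::finite \<Rightarrow> nat. (\<Sum>i\<in>UNIV. m i) = d}"
proof (rule finite_subset)
  show "{m :: 'n \<Rightarrow> nat. (\<Sum>i\<in>UNIV. m i) = d} \<subseteq> PiE UNIV (\<lambda>_. {..d})"
    by (auto intro: member_le_sum)
qed (auto intro: finite_PiE)

definition proj_zeros :: "(complex ^ 'n \<Rightarrow> complex) set \<Rightarrow> (complex ^ 'n) set set" where
  "proj_zeros S = {p \<in> proj_space. \<forall>f\<in>S. \<forall>v\<in>p. f v = 0}"

definition zariski_closed :: "(complex ^ 'n) set set \<Rightarrow> bool" where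
  "zariski_closed Z \<longleftrightarrow> (\<exists>S. (\<forall>f\<in>S. \<exists>d. form d f) \<and> Z = proj_zeros S)"

definition zariski_open_in :: "(complex ^ 'n) set set \<Rightarrow> (complex ^ 'n) set set \<Rightarrow> bool" where
  "zariski_open_in X V \<longleftrightarrow> (\<exists>Z. zariski_closed Z \<and> V = X - Z)"

definition partial_deriv :: "'n \<Rightarrow> (complex ^ 'n \<Rightarrow> complex) \<Rightarrow> complex ^ 'n \<Rightarrow> complex" where
  "partial_deriv i f v = deriv (\<lambda>t. f (v + axis i t)) 0"

text \<open>A smooth conic is cut out of a plane by a quadric such that the Jacobian matrix of the two
  equations has rank 2 at every point. In particular the quadric does not contain the plane,
  and the conic is reduced, hence determined by its set of points.\<close>

definition smooth_conic :: "(complex ^ 4) set set \<Rightarrow> bool" where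
  "smooth_conic C \<longleftrightarrow> (\<exists>l q. form 1 l \<and> l \<noteq> (\<lambda>_. 0) \<and> form 2 q \<and> C = proj_zeros {l, q} \<and>
     (\<forall>p\<in>C. \<forall>v\<in>p - {0}. \<forall>a b.
        (\<forall>i. a * partial_deriv i l v + b * partial_deriv i q v = 0) \<longrightarrow> a = 0 \<and> b = 0))"

definition g0 :: "complex ^ 4 \<Rightarrow> complex" where
  "g0 v = (let x = v $ 0; y = v $ 1; z = v $ 2; w = v $ 3 in x^4 + y^4 + z^4 + w^4)"

definition g1 :: "complex ^ 4 \<Rightarrow> complex" where
  "g1 v = (let x = v $ 0; y = v $ 1; z = v $ 2; w = v $ 3 in 2 * (x^2 * y^2 + z^2 * w^2))"

definition g2 :: "complex ^ 4 \<Rightarrow> complex" where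
  "g2 v = (let x = v $ 0; y = v $ 1; z = v $ 2; w = v $ 3 in 2 * (x^2 * z^2 + y^2 * w^2))"

definition g3 :: "complex ^ 4 \<Rightarrow> complex" where
  "g3 v = (let x = v $ 0; y = v $ 1; z = v $ 2; w = v $ 3 in 2 * (x^2 * w^2 + y^2 * z^2))"

definition g4 :: "complex ^ 4 \<Rightarrow> complex" where
  "g4 v = (let x = v $ 0; y = v $ 1; z = v $ 2; w = v $ 3 in 4 * x * y * z * w)"

definition U :: "(complex ^ 6) set set" where
  "U = proj_zeros {\<lambda>u. u $ 0 + u $ 1 + u $ 2 + u $ 3 + u $ 4 + u $ 5}"

definition heisenberg_form :: "complex ^ 6 \<Rightarrow> complex ^ 4 \<Rightarrow> complex" where
  "heisenberg_form u v =
    (let A = - u $ 4 - u $ 5;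
         B = - u $ 0 - u $ 1 + u $ 2 + u $ 3;
         C = - u $ 0 + u $ 1 - u $ 2 + u $ 3;
         D = - u $ 0 + u $ 1 + u $ 2 - u $ 3;
         E = 2 * u $ 4 - 2 * u $ 5
     in A * g0 v + B * g1 v + C * g2 v + D * g3 v + E * g4 v)"

text \<open>All representatives of the projective point \<open>p\<close> give proportional equations, so nothing
  depends on a choice.\<close>

definition heisenberg_quartic :: "(complex ^ 6) set \<Rightarrow> (complex ^ 4) set set" where
  "heisenberg_quartic p = proj_zeros (heisenberg_form ` p)"

end

theory Submission
  imports Defs
begin

text \<open>The five invariants \<open>g0, ..., g4\<close> make the invariant quartics the points of a projective 4-space with
  coordinates \<open>A, B, C, D, E\<close>. The general points of the Segre cubic
  \<open>A\<^sup>3 + A E\<^sup>2 - A (B\<^sup>2 + C\<^sup>2 + D\<^sup>2) + 2 B C D = 0\<close> are the Kummer surfaces among them, and the ten nodes of that cubic are the squares \<open>Q\<^sup>2\<close> of the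
  ten fundamental quadrics.

  The line that joins a point \<open>F\<close> to a node of a cubic meets the cubic in just one further point. So each of the
  ten quadrics gives an identity \<open>\<delta> F = K + \<sigma> Q\<^sup>2\<close> with a Kummer surface \<open>K\<close> and with \<open>\<sigma>\<close>, \<open>\<delta>\<close> polynomial
  in the coefficients of \<open>F\<close> (\<open>quartic_residual\<close>, \<open>segre_residual\<close>, \<open>quartic_node\<close>). A Kummer
  surface has 16 tropes, planes in which its equation is a square, \<open>K = A' \<phi>\<^sup>2\<close>. In such a plane
  \<open>\<delta> F = A' \<phi>\<^sup>2 + \<sigma> Q\<^sup>2 = (r \<phi> + t Q) (r \<phi> - t Q)\<close> with \<open>r\<^sup>2 = A'\<close>, \<open>t\<^sup>2 = - \<sigma>\<close>, so the plane cuts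
  the quartic in two conics. Altogether there are 10 times 16 times 2 of them.

  The tropes come from a trigonometric parametrization of the Segre cubic. Write \<open>B/A\<close>, \<open>C/A\<close>, \<open>D/A\<close> as
  \<open>cos 2x\<close>, \<open>cos 2y\<close>, \<open>cos 2z\<close> and take the angles \<open>x+y+z\<close>, \<open>x-y-z\<close>, \<open>-x+y-z\<close>, \<open>-x-y+z\<close>,
  whose sum is zero. With \<open>a i\<close> a square root of the sine and \<open>c i\<close> the cosine of the \<open>i\<close>th angle, the Kummer
  equation is \<open>A\<close> times the square of \<open>\<phi> = (\<Sum>i. c i * v i\<^sup>2)\<close> plus \<open>A\<close> times the product of the four linear forms
  obtained from \<open>a\<close> by even sign changes (\<open>quartic_kummer\<close>); the equation of the cubic says that the signs
  of the square roots can be chosen to fit \<open>E\<close> (\<open>ex_kummer_trope\<close>). The Heisenberg group moves one trope to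
  the 16 planes (\<open>kummer_trope_heisenberg\<close>).

  Three points need genericity. The conics are smooth because a bordered determinant does not vanish; for
  both types of fundamental quadric this determinant factors, and the product of its values at \<open>t\<close> and \<open>-t\<close> is,
  up to nonzero factors, a polynomial in \<open>\<sigma>\<close> and the coefficients of \<open>K\<close> (\<open>conic_nondegenerate\<close>). A smooth conic spans its plane
  (\<open>conic_spans_plane\<close>), so conics in different planes differ; planes in one Heisenberg orbit are told
  apart by the fourth powers of the \<open>a i\<close> (\<open>heisenberg_orbit_free\<close>) and planes that belong to different
  quadrics by invariants of the group (\<open>tropes_of_distinct_kummers\<close>). The two conics in one plane differ since
  equal conics have equal polars (\<open>polars_of_equal_conics\<close>), which would make the polars of \<open>\<phi>\<close> and \<open>Q\<close>
  dependent at some point (\<open>ex_test_vector\<close>). All conditions are the nonvanishing of forms in the parameters.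
  The open set is where their product is nonzero, and one explicit integral point shows that it is not empty.\<close>

section \<open>The index type with four elements\<close>

lemma UNIV_type_4: "(UNIV :: 4 set) = {0, 1, 2, 3}"
  unfolding UNIV_4 by auto

lemma sum_over_4: "(\<Sum>i\<in>(UNIV :: 4 set). f i) = f 0 + f 1 + f 2 + f 3"
  unfolding UNIV_type_4 by (simp add: add.assoc)

lemma all_4: "(\<forall>i :: 4. P i) \<longleftrightarrow> P 0 \<and> P 1 \<and> P 2 \<and> P 3"
  using UNIV_type_4 by (metis (full_types) UNIV_I empty_iff insert_iff)

lemma cases_4 [case_names 0 1 2 3]: "(i = 0 \<Longrightarrow> P) \<Longrightarrow> (i = 1 \<Longrightarrow> P) \<Longrightarrow> (i = 2 \<Longrightarrow> P) \<Longrightarrow> (i = 3 \<Longrightarrow> P) \<Longrightarrow> P" for i :: 4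
  using UNIV_type_4 by (metis (full_types) UNIV_I empty_iff insert_iff)

lemma vec_eq_4: "v = w \<longleftrightarrow> v $ 0 = w $ 0 \<and> v $ 1 = w $ 1 \<and> v $ 2 = w $ 2 \<and> v $ 3 = w $ (3 :: 4)"
  by (simp add: vec_eq_iff all_4)

section \<open>Homogeneous forms\<close>

lemma form_scale:
  assumes "form d f" shows "form d (\<lambda>v. k * f v)"
proof -
  obtain c where c: "f = (\<lambda>v. \<Sum>m | (\<Sum>i\<in>UNIV. m i) = d. c m * (\<Prod>i\<in>UNIV. v $ i ^ m i))"
    using assms unfolding form_def by blast
  show ?thesis unfolding form_def
    by (rule exI[of _ "\<lambda>m. k * c m"]) (simp add: c sum_distrib_left mult.assoc)
qed

lemma form_add:
  assumes "form d f" "form d g" shows "form d (\<lambda>v. f v + g v)"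
proof -
  obtain c where c: "f = (\<lambda>v. \<Sum>m | (\<Sum>i\<in>UNIV. m i) = d. c m * (\<Prod>i\<in>UNIV. v $ i ^ m i))"
    using assms unfolding form_def by blast
  obtain c' where c': "g = (\<lambda>v. \<Sum>m | (\<Sum>i\<in>UNIV. m i) = d. c' m * (\<Prod>i\<in>UNIV. v $ i ^ m i))"
    using assms unfolding form_def by blast
  show ?thesis unfolding form_def
    by (rule exI[of _ "\<lambda>m. c m + c' m"]) (simp add: c c' sum.distrib distrib_right)
qed

lemma form_diff:
  assumes "form d f" "form d g" shows "form d (\<lambda>v. f v - g v)"
  using form_add[OF assms(1) form_scale[OF assms(2), of "-1"]] by simp

lemma form_uminus: "form d f \<Longrightarrow> form d (\<lambda>v. - f v)"
  using form_scale[of d f "-1"] by simp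

lemma form_sum:
  assumes "finite I" "\<And>i. i \<in> I \<Longrightarrow> form d (f i)" shows "form d (\<lambda>v. \<Sum>i\<in>I. f i v)"
  using assms
proof (induction I rule: finite_induct)
  case empty
  show ?case unfolding form_def by (rule exI[of _ "\<lambda>_. 0"]) simp
next
  case (insert i I)
  then show ?case by (simp add: form_add)
qed

text \<open>A monomial is the form whose only nonzero coefficient is 1; with sums and multiples this generates all forms.\<close>

lemma form_monomial:
  fixes m :: "'n::finite \<Rightarrow> nat"
  assumes "(\<Sum>i\<in>UNIV. m i) = d"
  shows "form d (\<lambda>v. \<Prod>i\<in>UNIV. v $ i ^ m i)"
proof -
  have "(\<Prod>i\<in>UNIV. v $ i ^ m i) =
      (\<Sum>m' | (\<Sum>i\<in>UNIV. m' i) = d. of_bool (m' = m) * (\<Prod>i\<in>UNIV. v $ i ^ m' i))" for v :: "complex^'n"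
  proof -
    have "(\<Sum>m' | (\<Sum>i\<in>UNIV. m' i) = d. of_bool (m' = m) * (\<Prod>i\<in>UNIV. v $ i ^ m' i)) =
        (\<Sum>m' | (\<Sum>i\<in>UNIV. m' i) = d. if m' = m then (\<Prod>i\<in>UNIV. v $ i ^ m' i) else 0)"
      by (rule sum.cong) auto
    then show ?thesis using assms by (simp add: finite_exponents)
  qed
  then show ?thesis unfolding form_def by (intro exI[of _ "\<lambda>m'. of_bool (m' = m)"] ext)
qed

lemma form_mult:
  fixes f g :: "complex ^ 'n::finite \<Rightarrow> complex"
  assumes "form d f" "form e g" "d + e = k" shows "form k (\<lambda>v. f v * g v)"
proof -
  obtain c where c: "f = (\<lambda>v. \<Sum>m | (\<Sum>i\<in>UNIV. m i) = d. c m * (\<Prod>i\<in>UNIV. v $ i ^ m i))"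
    using assms unfolding form_def by blast
  obtain c' where c': "g = (\<lambda>v. \<Sum>m | (\<Sum>i\<in>UNIV. m i) = e. c' m * (\<Prod>i\<in>UNIV. v $ i ^ m i))"
    using assms unfolding form_def by blast
  have "f v * g v = (\<Sum>m | (\<Sum>i\<in>UNIV. m i) = d. \<Sum>m' | (\<Sum>i\<in>UNIV. m' i) = e.
      (c m * c' m') * (\<Prod>i\<in>UNIV. v $ i ^ (m i + m' i)))" for v
    unfolding c c' sum_product by (intro sum.cong refl) (simp add: power_add prod.distrib mult_ac)
  moreover have "form k (\<lambda>v. \<Sum>m | (\<Sum>i\<in>UNIV. m i) = d. \<Sum>m' | (\<Sum>i\<in>UNIV. m' i) = e.
      (c m * c' m') * (\<Prod>i\<in>UNIV. (v :: complex^'n) $ i ^ (m i + m' i)))"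
    using assms(3) by (intro form_sum finite_exponents form_scale form_monomial) (auto simp: sum.distrib)
  ultimately show ?thesis by simp
qed

lemma form_coordinate: "form 1 (\<lambda>v. v $ j)"
proof -
  have "(\<Prod>i\<in>UNIV. v $ i ^ of_bool (i = j)) = v $ j" for v :: "complex^'a"
  proof -
    have "(\<Prod>i\<in>UNIV. v $ i ^ of_bool (i = j)) = (\<Prod>i\<in>UNIV. if i = j then v $ i else 1)"
      by (rule prod.cong) auto
    then show ?thesis by simp
  qed
  then show ?thesis
    using form_monomial[of "\<lambda>i. of_bool (i = j)" 1] by (simp add: of_bool_def)
qed

lemma form_power:
  fixes f :: "complex ^ 'n::finite \<Rightarrow> complex"
  assumes "form d f" "d * n = k" shows "form k (\<lambda>v. f v ^ n)"
  using assms(2)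
proof (induction n arbitrary: k)
  case 0
  have "form 0 (\<lambda>v :: complex^'n. 1)"
    using form_monomial[of "\<lambda>_. 0" 0] by simp
  with 0 show ?case by simp
next
  case (Suc n)
  then show ?case using form_mult[OF assms(1) Suc.IH[OF refl], of k] by simp
qed

lemma form_prod:
  fixes f :: "'i \<Rightarrow> complex ^ 'n::finite \<Rightarrow> complex"
  assumes "finite I" "\<And>i. i \<in> I \<Longrightarrow> \<exists>d. form d (f i)" shows "\<exists>d. form d (\<lambda>v. \<Prod>i\<in>I. f i v)"
  using assms
proof (induction I rule: finite_induct)
  case empty
  have "form 0 (\<lambda>v :: complex^'n. 1)"
    using form_monomial[of "\<lambda>_. 0" 0] by simp
  then show ?case by auto
next
  case (insert i I)
  then show ?case using form_mult[OF _ _ refl] by simp blast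
qed

section \<open>Conics in a plane of projective 3-space\<close>

definition dot :: "complex ^ 'n \<Rightarrow> complex ^ 'n \<Rightarrow> complex" where
  "dot a v = (\<Sum>i\<in>UNIV. a $ i * v $ i)"

definition quad :: "complex ^ 'n ^ 'n \<Rightarrow> complex ^ 'n \<Rightarrow> complex" where
  "quad M v = dot v (M *v v)"

definition plane_conic :: "complex ^ 'n \<Rightarrow> complex ^ 'n ^ 'n \<Rightarrow> (complex ^ 'n) set set" where
  "plane_conic a M = proj_zeros {dot a, quad M}"

text \<open>The bordered matrix \<open>[[M, a], [a, 0]]\<close> is injective, that is, \<open>M\<close> restricts to a nondegenerate form on the plane.\<close>

definition nondegenerate_on :: "complex ^ 'n \<Rightarrow> complex ^ 'n ^ 'n \<Rightarrow> bool" where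
  "nondegenerate_on a M \<longleftrightarrow> (\<forall>v \<mu>. dot a v = 0 \<longrightarrow> M *v v = \<mu> *s a \<longrightarrow> v = 0)"

lemma dot_simps [simp]:
  "dot a (v + w) = dot a v + dot a w" "dot (v + w) a = dot v a + dot w a"
  "dot a (v - w) = dot a v - dot a w" "dot (v - w) a = dot v a - dot w a"
  "dot a (t *s v) = t * dot a v" "dot (t *s v) a = t * dot v a" "dot 0 a = 0" "dot a 0 = 0"
  by (simp_all add: dot_def sum.distrib sum_subtractf algebra_simps sum_distrib_left)

lemma dot_commute: "dot a v = dot v a"
  by (simp add: dot_def mult.commute)

lemma dot_axis [simp]: "dot a (axis i t) = a $ i * t" "dot (axis i t) a = a $ i * t"
proof -
  have "dot a (axis i t) = (\<Sum>j\<in>UNIV. if j = i then a $ j * t else 0)"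
    unfolding dot_def by (rule sum.cong) (auto simp: axis_def)
  then show "dot a (axis i t) = a $ i * t" by simp
  then show "dot (axis i t) a = a $ i * t" by (simp add: dot_commute)
qed

lemma dot_transpose: "dot v (M *v w) = dot (transpose M *v v) w"
proof -
  have "dot v (M *v w) = (\<Sum>i\<in>UNIV. \<Sum>j\<in>UNIV. v $ i * (M $ i $ j * w $ j))"
    by (simp add: dot_def matrix_vector_mult_def sum_distrib_left)
  also have "\<dots> = (\<Sum>j\<in>UNIV. \<Sum>i\<in>UNIV. v $ i * (M $ i $ j * w $ j))"
    by (rule sum.swap)
  also have "\<dots> = dot (transpose M *v v) w"
    by (simp add: dot_def matrix_vector_mult_def sum_distrib_left transpose_def mult_ac)
  finally show ?thesis .
qed

lemma dot_symmetric:
  assumes "transpose M = M" shows "dot v (M *v w) = dot w (M *v v)"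
  using dot_transpose[of v M w] assms by (simp add: dot_commute)

lemma quad_line:
  assumes "transpose M = M"
  shows "quad M (v + t *s w) = quad M v + 2 * t * dot v (M *v w) + t\<^sup>2 * quad M w"
  using dot_symmetric[OF assms, of v w]
  by (simp add: quad_def matrix_vector_right_distrib vector_scalar_commute algebra_simps power2_eq_square)

lemma quad_scale: "quad M (t *s v) = t\<^sup>2 * quad M v"
  by (simp add: quad_def vector_scalar_commute power2_eq_square)

lemma form_dot: "form 1 (dot a)"
proof -
  have "dot a = (\<lambda>v. \<Sum>i\<in>UNIV. a $ i * v $ i)" by (simp add: dot_def fun_eq_iff)
  moreover have "form 1 (\<lambda>v. \<Sum>i\<in>UNIV. a $ i * v $ i)"
    by (intro form_sum form_scale form_coordinate) auto
  ultimately show ?thesis by simp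
qed

lemma form_quad: "form 2 (quad M)"
proof -
  have "quad M = (\<lambda>v. \<Sum>i\<in>UNIV. \<Sum>j\<in>UNIV. M $ i $ j * (v $ i * v $ j))"
    by (simp add: quad_def dot_def matrix_vector_mult_def sum_distrib_left fun_eq_iff mult_ac)
  moreover have "form 2 (\<lambda>v. \<Sum>i\<in>UNIV. \<Sum>j\<in>UNIV. M $ i $ j * (v $ i * v $ j))"
    by (intro form_sum form_scale form_mult[OF form_coordinate form_coordinate]) auto
  ultimately show ?thesis by simp
qed

lemma in_span_singleton: "w \<in> vec.span {v} \<longleftrightarrow> (\<exists>t. w = t *s v)"
  by (auto simp: vec.span_singleton)

lemma span_mem_plane_conic:
  assumes "v \<noteq> 0"
  shows "vec.span {v} \<in> plane_conic a M \<longleftrightarrow> dot a v = 0 \<and> quad M v = 0"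
proof -
  have "vec.span {v} \<in> proj_space" using assms by (auto simp: proj_space_def)
  moreover have "v \<in> vec.span {v}" by (simp add: vec.span_base)
  ultimately show ?thesis
    by (auto simp: plane_conic_def proj_zeros_def in_span_singleton quad_scale)
qed

lemma plane_conic_eqD:
  assumes "plane_conic a M = plane_conic a' M'" "dot a v = 0" "quad M v = 0"
  shows "dot a' v = 0 \<and> quad M' v = 0"
proof (cases "v = 0")
  case True
  then show ?thesis by (simp add: quad_def)
next
  case False
  then show ?thesis using assms span_mem_plane_conic by metis
qed

lemma partial_deriv_dot: "partial_deriv i (dot a) v = a $ i"
proof -
  have "((\<lambda>t. dot a (v + axis i t)) has_field_derivative a $ i) (at 0)"
    by (auto intro!: derivative_eq_intros)
  then show ?thesis unfolding partial_deriv_def by (rule DERIV_imp_deriv)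
qed

lemma partial_deriv_quad:
  assumes "transpose M = M"
  shows "partial_deriv i (quad M) v = 2 * (M *v v) $ i"
proof -
  have "t *s axis i (1::complex) = axis i t" for t
    by (simp add: vec_eq_iff axis_def)
  then have "quad M (v + axis i t) = quad M v + 2 * t * (M *v v) $ i + t\<^sup>2 * quad M (axis i 1)" for t
    using quad_line[OF assms, of v t "axis i 1"] dot_symmetric[OF assms, of v "axis i 1"] by simp
  then have "((\<lambda>t. quad M (v + axis i t)) has_field_derivative 2 * (M *v v) $ i) (at 0)"
    by (auto intro!: derivative_eq_intros)
  then show ?thesis unfolding partial_deriv_def by (rule DERIV_imp_deriv)
qed

text \<open>The two gradients are \<open>a\<close> and \<open>2 M v\<close>, so a linear relation between them at a point of the conic is an element of the
  kernel of the bordered matrix.\<close>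

lemma smooth_plane_conic:
  fixes a :: "complex ^ 4"
  assumes "a \<noteq> 0" "transpose M = M" "nondegenerate_on a M"
  shows "smooth_conic (plane_conic a M)"
  unfolding smooth_conic_def
proof (rule exI[of _ "dot a"], rule exI[of _ "quad M"], intro conjI ballI allI impI)
  show "dot a \<noteq> (\<lambda>_. 0)"
  proof
    assume "dot a = (\<lambda>_. 0)"
    then have "dot a (axis i 1) = 0" for i by simp
    with \<open>a \<noteq> 0\<close> show False by (simp add: vec_eq_iff)
  qed
next
  fix p v b c
  assume p: "p \<in> plane_conic a M" and v: "v \<in> p - {0}"
    and "\<forall>i. b * partial_deriv i (dot a) v + c * partial_deriv i (quad M) v = 0"
  then have *: "b * a $ i + 2 * c * (M *v v) $ i = 0" for i
    by (simp add: partial_deriv_dot partial_deriv_quad[OF assms(2)] mult_ac)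
  have "dot a v = 0" using p v by (auto simp: plane_conic_def proj_zeros_def)
  have "c = 0"
  proof (rule ccontr)
    assume "c \<noteq> 0"
    have "M *v v = (- b / (2 * c)) *s a"
      using * \<open>c \<noteq> 0\<close> by (auto simp: vec_eq_iff field_simps eq_neg_iff_add_eq_0)
    then show False using assms(3) \<open>dot a v = 0\<close> v unfolding nondegenerate_on_def by blast
  qed
  moreover from this have "b = 0" using * \<open>a \<noteq> 0\<close> by (auto simp: vec_eq_iff)
  ultimately show "b = 0" "c = 0" by auto
qed (simp_all only: form_dot form_quad plane_conic_def)

text \<open>If \<open>a $ i\<close> is nonzero, the vectors \<open>a $ i * e\<^sub>j - a $ j * e\<^sub>i\<close> span the plane annihilated by \<open>a\<close>.\<close>

lemma multiple_if_annihilator_le: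
  assumes "a \<noteq> 0" "\<And>v. dot a v = 0 \<Longrightarrow> dot b v = 0"
  shows "\<exists>t. b = t *s a"
proof -
  obtain i where i: "a $ i \<noteq> 0" using assms(1) by (auto simp: vec_eq_iff)
  have "b $ j = (b $ i / a $ i) * a $ j" for j
  proof -
    have "b $ j * a $ i = b $ i * a $ j"
      using assms(2)[of "axis j (a $ i) - axis i (a $ j)"] by (simp add: mult.commute)
    then show ?thesis using i by (simp add: nonzero_eq_divide_eq)
  qed
  then have "\<forall>j. b $ j = ((b $ i / a $ i) *s a) $ j" unfolding vector_smult_component by blast
  then have "b = (b $ i / a $ i) *s a" by (rule iffD2[OF vec_eq_iff])
  then show ?thesis ..
qed

text \<open>Padding the two functionals with zeros gives an endomorphism that is not surjective, hence not injective.\<close>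

lemma ex_common_annihilator:
  fixes a b :: "complex ^ 4"
  shows "\<exists>p. p \<noteq> 0 \<and> dot a p = 0 \<and> dot b p = 0"
proof -
  define c where "c v = (\<chi> i :: 4. if i = 0 then dot a v else if i = 1 then dot b v else 0)" for v
  have lin: "Vector_Spaces.linear (*s) (*s) c"
    by unfold_locales (auto simp: c_def vec_eq_iff algebra_simps)
  have "\<not> surj c"
  proof
    assume "surj c"
    then obtain v where "c v = axis 2 1" by (metis surj_def)
    then have "c v $ 2 = 1" by simp
    then show False by (simp add: c_def)
  qed
  then have "\<not> inj c" using vec.linear_inj_imp_surj[OF lin] by blast
  then obtain p where "p \<noteq> 0" "c p = 0" using vec.linear_inj_iff_eq_0[OF lin] by blast
  from this(2) have "c p $ 0 = 0" "c p $ 1 = 0" by simp_all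
  with \<open>p \<noteq> 0\<close> show ?thesis by (auto simp: c_def)
qed

text \<open>If the conic lay in the line \<open>a = b = 0\<close>, pick \<open>w\<close> in the plane off that line. For \<open>p\<close> on the line, the quadratic
  polynomial \<open>t \<mapsto> quad M (p + t w)\<close> can only have the root 0, since a root \<open>t \<noteq> 0\<close> is a point of the conic off the line.
  So both roots are 0, that is, \<open>p\<close> is isotropic and orthogonal to \<open>w\<close>. Then the whole line is isotropic and each of
  its points is in the kernel of the form on the plane, which contradicts nondegeneracy.\<close>

lemma conic_spans_plane:
  fixes a b :: "complex ^ 4"
  assumes "a \<noteq> 0" and sym: "transpose M = M" and nd: "nondegenerate_on a M"
    and van: "\<And>v. dot a v = 0 \<Longrightarrow> quad M v = 0 \<Longrightarrow> dot b v = 0"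
  shows "\<exists>t. b = t *s a"
proof (rule ccontr)
  assume "\<nexists>t. b = t *s a"
  then obtain w where w: "dot a w = 0" "dot b w \<noteq> 0"
    using multiple_if_annihilator_le[OF \<open>a \<noteq> 0\<close>] by blast
  have qw: "quad M w \<noteq> 0" using van w by blast
  have line: "quad M p = 0 \<and> dot p (M *v w) = 0" if "dot a p = 0" "dot b p = 0" for p
  proof -
    have no_root: "quad M (p + t *s w) \<noteq> 0" if "t \<noteq> 0" for t
      using van[of "p + t *s w"] w that \<open>dot a p = 0\<close> \<open>dot b p = 0\<close> by auto
    define m where "m = dot p (M *v w)"
    define d where "d = csqrt (m\<^sup>2 - quad M p * quad M w)"
    have d2: "d\<^sup>2 = m\<^sup>2 - quad M p * quad M w" by (simp add: d_def)
    have root: "quad M (p + ((e - m) / quad M w) *s w) = 0" if "e\<^sup>2 = d\<^sup>2" for e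
    proof -
      have "quad M w * quad M (p + ((e - m) / quad M w) *s w) = quad M p * quad M w + 2 * (e - m) * m + (e - m)\<^sup>2"
        using qw by (simp add: quad_line[OF sym] m_def field_simps power2_eq_square)
      also have "\<dots> = 0" using that d2 by algebra
      finally show ?thesis using qw by simp
    qed
    have "e = m" if "e\<^sup>2 = d\<^sup>2" for e
      using root[OF that] no_root[of "(e - m) / quad M w"] qw by auto
    from this[of d] this[of "- d"] have "d = m" "m = 0" by auto
    then show ?thesis using d2 qw by (simp add: m_def)
  qed
  obtain p where p: "p \<noteq> 0" "dot a p = 0" "dot b p = 0" using ex_common_annihilator by blast
  have "dot (M *v p) v = 0" if v: "dot a v = 0" for v
  proof -
    define t where "t = dot b v / dot b w"
    define p' where "p' = v - t *s w"
    have p': "dot a p' = 0" "dot b p' = 0" using v w by (simp_all add: p'_def t_def)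
    have "quad M (p + 1 *s p') = 0"
      using line[of "p + 1 *s p'"] p p' by simp
    then have "dot p (M *v p') = 0"
      using line[of p] line[of p'] p p' unfolding quad_line[OF sym] by simp
    moreover have "dot p (M *v w) = 0" using line p by blast
    moreover have "v = p' + t *s w" by (simp add: p'_def)
    ultimately have "dot p (M *v v) = 0"
      by (simp add: matrix_vector_right_distrib vector_scalar_commute)
    then show ?thesis using dot_symmetric[OF sym] by (simp add: dot_commute)
  qed
  then obtain \<mu> where "M *v p = \<mu> *s a" using multiple_if_annihilator_le[OF \<open>a \<noteq> 0\<close>] by blast
  then show False using nd p unfolding nondegenerate_on_def by blast
qed

text \<open>Let \<open>p\<close> be on the conic. On the line through \<open>p\<close> and \<open>w\<close> both quadratic forms vanish at \<open>p\<close> and at the same second point,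
  so the polars of \<open>w\<close> with respect to \<open>M\<close> and \<open>M'\<close> agree at \<open>p\<close> up to the factor \<open>quad M' w / quad M w\<close>, which does not
  depend on \<open>p\<close>. The conic spans the plane, so they agree on the plane up to this factor.\<close>

lemma polars_of_equal_conics:
  fixes a :: "complex ^ 4"
  assumes "a \<noteq> 0" and sym: "transpose M = M" "transpose M' = M'" and nd: "nondegenerate_on a M"
    and eq: "plane_conic a M = plane_conic a M'" and w: "dot a w = 0" "quad M w \<noteq> 0"
  shows "\<exists>\<kappa> \<mu>. M' *v w = \<kappa> *s (M *v w) + \<mu> *s a"
proof -
  define \<kappa> where "\<kappa> = quad M' w / quad M w"
  have iff: "quad M v = 0 \<longleftrightarrow> quad M' v = 0" if "dot a v = 0" for v
    using that plane_conic_eqD[OF eq] plane_conic_eqD[OF eq[symmetric]] by blast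
  have qw': "quad M' w \<noteq> 0" using iff w by blast
  have "dot (M' *v w - \<kappa> *s (M *v w)) p = 0" if p: "dot a p = 0" "quad M p = 0" for p
  proof -
    define m where "m = dot p (M *v w)"
    define m' where "m' = dot p (M' *v w)"
    have "quad M' p = 0" using iff p by blast
    then have roots: "t * (2 * m + t * quad M w) = 0 \<longleftrightarrow> t * (2 * m' + t * quad M' w) = 0" for t
      using iff[of "p + t *s w"] p w
      by (simp add: quad_line[OF sym(1)] quad_line[OF sym(2)] m_def m'_def power2_eq_square algebra_simps)
    have "m' * quad M w = m * quad M' w"
    proof (cases "m = 0")
      case True
      have "m' = 0" using roots[of "- 2 * m' / quad M' w"] qw' w(2) True by (auto simp: field_simps)
      with True show ?thesis by simp
    next
      case False
      then show ?thesis using roots[of "- 2 * m / quad M w"] w(2) by (simp add: field_simps)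
    qed
    then have "m' = \<kappa> * m" using w(2) by (simp add: \<kappa>_def field_simps)
    then show ?thesis by (simp add: m_def m'_def dot_commute[of _ p])
  qed
  then obtain \<mu> where "M' *v w - \<kappa> *s (M *v w) = \<mu> *s a"
    using conic_spans_plane[OF \<open>a \<noteq> 0\<close> sym(1) nd] by blast
  then have "M' *v w = \<kappa> *s (M *v w) + \<mu> *s a" by (simp add: algebra_simps)
  then show ?thesis by blast
qed

section \<open>Four angles with sum zero\<close>

lemma sin_pair_products:
  fixes x y z :: complex
  shows "sin (x + y + z) * sin (x - y - z) = (cos (2 * y + 2 * z) - cos (2 * x)) / 2"
    and "sin (- x + y - z) * sin (- x - y + z) = (cos (2 * y - 2 * z) - cos (2 * x)) / 2"
    and "cos (x + y + z) * cos (x - y - z) = (cos (2 * y + 2 * z) + cos (2 * x)) / 2"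
    and "cos (- x + y - z) * cos (- x - y + z) = (cos (2 * y - 2 * z) + cos (2 * x)) / 2"
proof -
  have *: "x + y + z - (x - y - z) = 2 * y + 2 * z" "x + y + z + (x - y - z) = 2 * x"
    by simp_all
  show "sin (x + y + z) * sin (x - y - z) = (cos (2 * y + 2 * z) - cos (2 * x)) / 2"
    unfolding sin_times_sin * by simp
  show "cos (x + y + z) * cos (x - y - z) = (cos (2 * y + 2 * z) + cos (2 * x)) / 2"
    unfolding cos_times_cos * by simp
  have *: "- x + y - z - (- x - y + z) = 2 * y - 2 * z" "- x + y - z + (- x - y + z) = - (2 * x)"
    by simp_all
  show "sin (- x + y - z) * sin (- x - y + z) = (cos (2 * y - 2 * z) - cos (2 * x)) / 2"
    unfolding sin_times_sin * by simp
  show "cos (- x + y - z) * cos (- x - y + z) = (cos (2 * y - 2 * z) + cos (2 * x)) / 2"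
    unfolding cos_times_cos * by simp
qed

lemma sin_pair_sum:
  fixes x y z :: complex
  shows "sin (x + y + z) * sin (x - y - z) + sin (- x + y - z) * sin (- x - y + z)
    = cos (2 * y) * cos (2 * z) - cos (2 * x)"
  unfolding sin_pair_products by (simp add: cos_add cos_diff field_simps)

text \<open>With \<open>A = 1\<close> and \<open>E\<^sup>2 = 4 * (product of the sines)\<close> this is the equation of the Segre cubic in terms of the three
  cosines.\<close>

lemma sin_product:
  fixes x y z :: complex
  shows "4 * (sin (x + y + z) * sin (x - y - z) * sin (- x + y - z) * sin (- x - y + z))
    = (cos (2 * x))\<^sup>2 + (cos (2 * y))\<^sup>2 + (cos (2 * z))\<^sup>2 - 1 - 2 * cos (2 * x) * cos (2 * y) * cos (2 * z)"
proof -
  have "4 * (sin (x + y + z) * sin (x - y - z) * sin (- x + y - z) * sin (- x - y + z))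
      = 4 * ((sin (x + y + z) * sin (x - y - z)) * (sin (- x + y - z) * sin (- x - y + z)))"
    by (simp only: mult.assoc)
  also have "\<dots> = (cos (2 * y + 2 * z) - cos (2 * x)) * (cos (2 * y - 2 * z) - cos (2 * x))"
    unfolding sin_pair_products by simp
  also have "\<dots> = (cos (2 * x))\<^sup>2 + (cos (2 * y))\<^sup>2 * (cos (2 * z))\<^sup>2 - (sin (2 * y))\<^sup>2 * (sin (2 * z))\<^sup>2
      - 2 * cos (2 * x) * cos (2 * y) * cos (2 * z)"
    by (simp add: cos_add cos_diff algebra_simps power2_eq_square)
  also have "\<dots> = (cos (2 * x))\<^sup>2 + (cos (2 * y))\<^sup>2 + (cos (2 * z))\<^sup>2 - 1 - 2 * cos (2 * x) * cos (2 * y) * cos (2 * z)"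
    unfolding sin_squared_eq by (simp add: algebra_simps)
  finally show ?thesis .
qed

text \<open>These are the coefficients of the bordered determinant of \<open>diag (r c\<^sub>i + t)\<close>, with squared border entries \<open>s\<^sub>i\<close>, as a
  polynomial in \<open>r\<close> and \<open>t\<close>. Because the angles have sum zero, the coefficient of \<open>r t\<^sup>2\<close> vanishes and the others are
  divisible by \<open>sin x sin y sin z\<close>.\<close>

lemma bordered_diagonal_coeffs:
  fixes x y z :: complex
  defines "s0 \<equiv> sin (x + y + z)" and "s1 \<equiv> sin (x - y - z)"
    and "s2 \<equiv> sin (- x + y - z)" and "s3 \<equiv> sin (- x - y + z)"
    and "c0 \<equiv> cos (x + y + z)" and "c1 \<equiv> cos (x - y - z)"
    and "c2 \<equiv> cos (- x + y - z)" and "c3 \<equiv> cos (- x - y + z)"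
  shows "s0 + s1 + s2 + s3 = - 4 * sin x * sin y * sin z" (is ?t3)
    and "s0 * (c1 + c2 + c3) + s1 * (c0 + c2 + c3) + s2 * (c0 + c1 + c3) + s3 * (c0 + c1 + c2) = 0" (is ?t2)
    and "s0 * (c1 * c2 + c1 * c3 + c2 * c3) + s1 * (c0 * c2 + c0 * c3 + c2 * c3)
        + s2 * (c0 * c1 + c0 * c3 + c1 * c3) + s3 * (c0 * c1 + c0 * c2 + c1 * c2)
      = 4 * sin x * sin y * sin z * ((cos x)\<^sup>2 + (cos y)\<^sup>2 + (cos z)\<^sup>2)" (is ?t1)
    and "s0 * (c1 * c2 * c3) + s1 * (c0 * c2 * c3) + s2 * (c0 * c1 * c3) + s3 * (c0 * c1 * c2)
      = 8 * sin x * sin y * sin z * cos x * cos y * cos z" (is ?t0)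
proof -
  note defs = s0_def s1_def s2_def s3_def c0_def c1_def c2_def c3_def
  have h: "sin p * cos q + sin q * cos p = sin (p + q)" for p q :: complex
    by (simp add: sin_add)
  have sc: "s0 * c1 + s1 * c0 = 2 * sin x * cos x" "s2 * c3 + s3 * c2 = - (2 * sin x * cos x)"
    "s0 * c2 + s2 * c0 = 2 * sin y * cos y" "s1 * c3 + s3 * c1 = - (2 * sin y * cos y)"
    "s0 * c3 + s3 * c0 = 2 * sin z * cos z" "s1 * c2 + s2 * c1 = - (2 * sin z * cos z)"
    unfolding defs h sin_double[symmetric] by (simp_all add: algebra_simps)
  have s01: "s0 + s1 = 2 * sin x * cos (y + z)" and s23: "s2 + s3 = - 2 * sin x * cos (y - z)"
    and c01: "c0 + c1 = 2 * cos x * cos (y + z)" and c23: "c2 + c3 = 2 * cos x * cos (y - z)"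
    unfolding defs
    by (simp_all add: sin_add sin_diff cos_add cos_diff algebra_simps)
  have cc: "c0 * c1 = ((2 * (cos (y + z))\<^sup>2 - 1) + (2 * (cos x)\<^sup>2 - 1)) / 2"
       "c2 * c3 = ((2 * (cos (y - z))\<^sup>2 - 1) + (2 * (cos x)\<^sup>2 - 1)) / 2"
    unfolding defs sin_pair_products cos_double_cos[symmetric] by (simp_all add: algebra_simps)
  have sub: "cos (y - z) - cos (y + z) = 2 * sin y * sin z"
    and prd: "cos (y - z) * cos (y + z) = (cos y)\<^sup>2 + (cos z)\<^sup>2 - 1"
    by (simp_all add: cos_add cos_diff) (simp add: algebra_simps power2_eq_square sin_squared_eq[unfolded power2_eq_square])
  show ?t3 using s01 s23 sub by algebra
  show ?t2 using sc by algebra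
  have "s0 * (c1 * c2 * c3) + s1 * (c0 * c2 * c3) + s2 * (c0 * c1 * c3) + s3 * (c0 * c1 * c2)
      = (s0 * c1 + s1 * c0) * (c2 * c3) + (s2 * c3 + s3 * c2) * (c0 * c1)"
    by (simp add: algebra_simps)
  also have "\<dots> = 2 * sin x * cos x * (c2 * c3 - c0 * c1)" unfolding sc by (simp add: algebra_simps)
  also have "c2 * c3 - c0 * c1 = (cos (y - z) - cos (y + z)) * (cos (y - z) + cos (y + z))"
    unfolding cc by (simp add: field_simps power2_eq_square)
  also have "cos (y - z) + cos (y + z) = 2 * cos y * cos z" by (simp add: cos_add cos_diff)
  finally show ?t0 unfolding sub by (simp add: algebra_simps)
  have "s0 * (c1 * c2 + c1 * c3 + c2 * c3) + s1 * (c0 * c2 + c0 * c3 + c2 * c3)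
        + s2 * (c0 * c1 + c0 * c3 + c1 * c3) + s3 * (c0 * c1 + c0 * c2 + c1 * c2)
      = (s0 * c1 + s1 * c0) * (c2 + c3) + (s2 * c3 + s3 * c2) * (c0 + c1)
        + (s0 + s1) * (c2 * c3) + (s2 + s3) * (c0 * c1)"
    by (simp add: algebra_simps)
  also have "\<dots> = 4 * sin x * (cos x)\<^sup>2 * (cos (y - z) - cos (y + z))
      + 2 * sin x * (cos (y + z) * (c2 * c3) - cos (y - z) * (c0 * c1))"
    unfolding sc s01 s23 c01 c23 by (simp add: algebra_simps power2_eq_square)
  also have "cos (y + z) * (c2 * c3) - cos (y - z) * (c0 * c1)
      = (cos (y - z) - cos (y + z)) * (cos (y - z) * cos (y + z) + 1 - (cos x)\<^sup>2)"
    unfolding cc by (simp add: field_simps power2_eq_square)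
  finally show ?t1 unfolding sub prd by (simp add: algebra_simps power2_eq_square)
qed

lemma bordered_diagonal_det:
  fixes x y z r t :: complex
  defines "m0 \<equiv> r * cos (x + y + z) + t" and "m1 \<equiv> r * cos (x - y - z) + t"
    and "m2 \<equiv> r * cos (- x + y - z) + t" and "m3 \<equiv> r * cos (- x - y + z) + t"
  shows "sin (x + y + z) * (m1 * m2 * m3) + sin (x - y - z) * (m0 * m2 * m3)
      + sin (- x + y - z) * (m0 * m1 * m3) + sin (- x - y + z) * (m0 * m1 * m2)
    = 4 * sin x * sin y * sin z * (2 * r^3 * cos x * cos y * cos z
        + r\<^sup>2 * t * ((cos x)\<^sup>2 + (cos y)\<^sup>2 + (cos z)\<^sup>2) - t^3)"
proof -
  define s0 s1 s2 s3 c0 c1 c2 c3 where defs: "s0 = sin (x + y + z)" "s1 = sin (x - y - z)"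
    "s2 = sin (- x + y - z)" "s3 = sin (- x - y + z)" "c0 = cos (x + y + z)" "c1 = cos (x - y - z)"
    "c2 = cos (- x + y - z)" "c3 = cos (- x - y + z)"
  note coeffs = bordered_diagonal_coeffs[of x y z, folded defs]
  have "s0 * (m1 * m2 * m3) + s1 * (m0 * m2 * m3) + s2 * (m0 * m1 * m3) + s3 * (m0 * m1 * m2)
    = r^3 * (s0 * (c1 * c2 * c3) + s1 * (c0 * c2 * c3) + s2 * (c0 * c1 * c3) + s3 * (c0 * c1 * c2))
      + r\<^sup>2 * t * (s0 * (c1 * c2 + c1 * c3 + c2 * c3) + s1 * (c0 * c2 + c0 * c3 + c2 * c3)
        + s2 * (c0 * c1 + c0 * c3 + c1 * c3) + s3 * (c0 * c1 + c0 * c2 + c1 * c2))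
      + r * t\<^sup>2 * (s0 * (c1 + c2 + c3) + s1 * (c0 + c2 + c3) + s2 * (c0 + c1 + c3) + s3 * (c0 + c1 + c2))
      + t^3 * (s0 + s1 + s2 + s3)"
    unfolding m0_def m1_def m2_def m3_def defs[symmetric]
    by (simp add: algebra_simps power2_eq_square power3_eq_cube)
  also have "\<dots> = 4 * sin x * sin y * sin z * (2 * r^3 * cos x * cos y * cos z
        + r\<^sup>2 * t * ((cos x)\<^sup>2 + (cos y)\<^sup>2 + (cos z)\<^sup>2) - t^3)"
    unfolding coeffs by (simp add: algebra_simps)
  finally show ?thesis unfolding defs .
qed

lemma nonzero_if_cos_double:
  fixes x b A :: complex
  assumes "A * cos (2 * x) = b" "b \<noteq> A"
  shows "sin x \<noteq> 0"
proof
  assume "sin x = 0"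
  then have "cos (2 * x) = 1" by (simp add: cos_double_sin)
  with assms show False by simp
qed

text \<open>The second factor of the determinant involves the square roots \<open>r\<close>, \<open>t\<close>, \<open>cos x\<close>, \<open>cos y\<close>, \<open>cos z\<close>. Its term
  \<open>2 r\<^sup>3 cos x cos y cos z\<close> and \<open>t\<close> times the rest have squares that are polynomials in \<open>A\<close>, \<open>b\<close>, \<open>c\<close>, \<open>d\<close>,
  \<open>S\<close>, since \<open>2 r\<^sup>2 (cos x)\<^sup>2 = A + b\<close>; the hypothesis \<open>disc\<close> says that these two squares differ.\<close>

lemma bordered_diagonal_det_nonzero:
  fixes x y z r t A S b c d :: complex
  defines "m0 \<equiv> r * cos (x + y + z) + t" and "m1 \<equiv> r * cos (x - y - z) + t"
    and "m2 \<equiv> r * cos (- x + y - z) + t" and "m3 \<equiv> r * cos (- x - y + z) + t"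
  assumes x: "A * cos (2 * x) = b" "b \<noteq> A" and y: "A * cos (2 * y) = c" "c \<noteq> A"
    and z: "A * cos (2 * z) = d" "d \<noteq> A" and r: "r\<^sup>2 = A" and t: "t\<^sup>2 = - S"
    and disc: "2 * (A + b) * (A + c) * (A + d) + S * (3 * A + b + c + d + 2 * S)\<^sup>2 \<noteq> 0"
  shows "sin (x + y + z) * (m1 * m2 * m3) + sin (x - y - z) * (m0 * m2 * m3)
      + sin (- x + y - z) * (m0 * m1 * m3) + sin (- x - y + z) * (m0 * m1 * m2) \<noteq> 0"
proof -
  have "2 * r^3 * cos x * cos y * cos z + r\<^sup>2 * t * ((cos x)\<^sup>2 + (cos y)\<^sup>2 + (cos z)\<^sup>2) - t^3 \<noteq> 0"
  proof
    assume *: "2 * r^3 * cos x * cos y * cos z + r\<^sup>2 * t * ((cos x)\<^sup>2 + (cos y)\<^sup>2 + (cos z)\<^sup>2) - t^3 = 0"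
    have b: "2 * r\<^sup>2 * (cos x)\<^sup>2 = A + b" and c: "2 * r\<^sup>2 * (cos y)\<^sup>2 = A + c" and d: "2 * r\<^sup>2 * (cos z)\<^sup>2 = A + d"
      using x(1) y(1) z(1) unfolding r cos_double_cos by (simp_all add: algebra_simps)
    have "2 * r^3 * cos x * cos y * cos z = t * (t\<^sup>2 - r\<^sup>2 * ((cos x)\<^sup>2 + (cos y)\<^sup>2 + (cos z)\<^sup>2))"
      using * by (simp add: algebra_simps power2_eq_square power3_eq_cube)
    then have "(2 * r^3 * cos x * cos y * cos z)\<^sup>2 = t\<^sup>2 * (t\<^sup>2 - r\<^sup>2 * ((cos x)\<^sup>2 + (cos y)\<^sup>2 + (cos z)\<^sup>2))\<^sup>2"
      by (simp add: power_mult_distrib)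
    moreover have "4 * (2 * r^3 * cos x * cos y * cos z)\<^sup>2 = 2 * (2 * r\<^sup>2 * (cos x)\<^sup>2) * (2 * r\<^sup>2 * (cos y)\<^sup>2) * (2 * r\<^sup>2 * (cos z)\<^sup>2)"
      by (simp add: power_mult_distrib flip: power_mult)
    moreover have "4 * (t\<^sup>2 * (t\<^sup>2 - r\<^sup>2 * ((cos x)\<^sup>2 + (cos y)\<^sup>2 + (cos z)\<^sup>2))\<^sup>2)
      = t\<^sup>2 * (2 * t\<^sup>2 - (2 * r\<^sup>2 * (cos x)\<^sup>2 + 2 * r\<^sup>2 * (cos y)\<^sup>2 + 2 * r\<^sup>2 * (cos z)\<^sup>2))\<^sup>2"
      by (simp add: algebra_simps power2_eq_square)
    ultimately have "2 * (A + b) * (A + c) * (A + d) = - S * (- 2 * S - (A + b + (A + c) + (A + d)))\<^sup>2"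
      unfolding b c d t by simp
    then show False using disc by (simp add: algebra_simps power2_eq_square)
  qed
  then show ?thesis
    unfolding m0_def m1_def m2_def m3_def bordered_diagonal_det
    using nonzero_if_cos_double[OF x] nonzero_if_cos_double[OF y] nonzero_if_cos_double[OF z] by simp
qed

lemma sin_add_nonzero:
  fixes y z c d A :: complex
  assumes "A \<noteq> 0" "A * cos (2 * y) = c" "A * cos (2 * z) = d" "c\<^sup>2 \<noteq> d\<^sup>2"
  shows "sin (2 * y + 2 * z) \<noteq> 0" "sin (2 * y - 2 * z) \<noteq> 0"
proof -
  have "sin (2 * y + 2 * z) * sin (2 * y - 2 * z) = (cos (2 * z))\<^sup>2 - (cos (2 * y))\<^sup>2"
    unfolding sin_add sin_diff
    by (simp add: algebra_simps power2_eq_square sin_squared_eq[unfolded power2_eq_square])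
  moreover have "c\<^sup>2 = A\<^sup>2 * (cos (2 * y))\<^sup>2" "d\<^sup>2 = A\<^sup>2 * (cos (2 * z))\<^sup>2"
    using assms by (auto simp: power_mult_distrib)
  ultimately have "sin (2 * y + 2 * z) * sin (2 * y - 2 * z) \<noteq> 0" using assms(4) by auto
  then show "sin (2 * y + 2 * z) \<noteq> 0" "sin (2 * y - 2 * z) \<noteq> 0" by auto
qed

section \<open>The Heisenberg group and the fundamental quadrics\<close>

text \<open>Addition of the Klein four-group on the indices, with 0 as neutral element. The translations \<open>klein_add k\<close> and the
  characters \<open>chi l\<close> make up the Heisenberg group modulo its centre.\<close>

definition klein_add :: "4 \<Rightarrow> 4 \<Rightarrow> 4" where
  "klein_add k i = (if k = 0 then i else if i = 0 then k else if i = k then 0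
     else if k \<noteq> 1 \<and> i \<noteq> 1 then 1 else if k \<noteq> 2 \<and> i \<noteq> 2 then 2 else 3)"

definition chi :: "4 \<Rightarrow> 4 \<Rightarrow> complex" where
  "chi l i = (if l = 0 \<or> i = 0 \<or> i = l then 1 else -1)"

definition heisenberg_action :: "4 \<Rightarrow> 4 \<Rightarrow> complex ^ 4 \<Rightarrow> complex ^ 4" where
  "heisenberg_action k l v = (\<chi> i. chi l i * v $ klein_add k i)"

lemma klein_add_self [simp]: "klein_add k k = 0"
  by (simp add: klein_add_def)

lemma klein_add_involutive [simp]: "klein_add k (klein_add k i) = i"
  by (cases k rule: cases_4; cases i rule: cases_4; simp add: klein_add_def)

lemma chi_square [simp]: "chi l i * chi l i = 1" "(chi l i)\<^sup>2 = 1" "chi l 0 = 1"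
  by (auto simp: chi_def)

lemma chi_eqD:
  assumes "\<And>i. chi l i = chi l' i" shows "l = l'"
  using assms[of 1] assms[of 2]
  by (cases l rule: cases_4; cases l' rule: cases_4) (simp_all add: chi_def)

text \<open>For these pairs the bilinear form \<open>\<Sum>i. chi l i * v i * w (klein_add k i)\<close> is symmetric (for the other six it is alternating);
  so they index the ten fundamental quadrics.\<close>

definition even_pairs :: "(4 \<times> 4) set" where
  "even_pairs = {(k, l). chi l k = 1}"

lemma even_pairs_eq: "even_pairs = {(0,0), (0,1), (0,2), (0,3), (1,0), (1,1), (2,0), (2,2), (3,0), (3,3)}"
proof (rule set_eqI)
  fix p :: "4 \<times> 4"
  obtain k l where p: "p = (k, l)" by fastforce
  show "p \<in> even_pairs \<longleftrightarrow> p \<in> {(0,0), (0,1), (0,2), (0,3), (1,0), (1,1), (2,0), (2,2), (3,0), (3,3)}"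
    unfolding p by (cases k rule: cases_4; cases l rule: cases_4; simp add: even_pairs_def chi_def)
qed

lemma card_even_pairs: "card even_pairs = 10"
  unfolding even_pairs_eq by simp

definition fundamental_matrix :: "4 \<Rightarrow> 4 \<Rightarrow> complex ^ 4 ^ 4" where
  "fundamental_matrix k l = (\<chi> i j. if j = klein_add k i then chi l i else 0)"

lemma fundamental_matrix_mult: "(fundamental_matrix k l *v v) $ i = chi l i * v $ klein_add k i"
  by (simp add: fundamental_matrix_def matrix_vector_mult_def if_distrib[of "\<lambda>x. x * _"] cong: if_cong)

lemma transpose_fundamental_matrix: "(k, l) \<in> even_pairs \<Longrightarrow> transpose (fundamental_matrix k l) = fundamental_matrix k l"
  unfolding even_pairs_eq
  by (elim insertE; simp add: transpose_def fundamental_matrix_def vec_eq_4 klein_add_def chi_def)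

lemma quad_fundamental_matrix: "quad (fundamental_matrix k l) v = (\<Sum>i\<in>UNIV. chi l i * v $ i * v $ klein_add k i)"
  by (simp add: quad_def dot_def fundamental_matrix_mult mult_ac)

section \<open>Invariant quartics and the Segre cubic\<close>

datatype coeffs = Coeffs (cA: complex) (cB: complex) (cC: complex) (cD: complex) (cE: complex)

definition quartic :: "coeffs \<Rightarrow> complex ^ 4 \<Rightarrow> complex" where
  "quartic w v = cA w * g0 v + cB w * g1 v + cC w * g2 v + cD w * g3 v + cE w * g4 v"

definition segre :: "coeffs \<Rightarrow> complex" where
  "segre w = cA w^3 + cA w * (cE w)\<^sup>2 - cA w * ((cB w)\<^sup>2 + (cC w)\<^sup>2 + (cD w)\<^sup>2) + 2 * cB w * cC w * cD w"

text \<open>The derivative of the Segre cubic at \<open>w\<close> in the direction \<open>n\<close>.\<close>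

definition segre_deriv :: "coeffs \<Rightarrow> coeffs \<Rightarrow> complex" where
  "segre_deriv n w = (3 * (cA w)\<^sup>2 + (cE w)\<^sup>2 - (cB w)\<^sup>2 - (cC w)\<^sup>2 - (cD w)\<^sup>2) * cA n
    + 2 * (cC w * cD w - cA w * cB w) * cB n + 2 * (cB w * cD w - cA w * cC w) * cC n
    + 2 * (cB w * cC w - cA w * cD w) * cD n + 2 * cA w * cE w * cE n"

text \<open>The coefficients of the square of a fundamental quadric. For \<open>k \<noteq> 0\<close> the quadric is \<open>2 (v 0 * v k \<plusminus> v m * v n)\<close> with
  \<open>{m, n}\<close> the complement of \<open>{0, k}\<close>, and the sign is the value of \<open>chi l\<close> on that complement.\<close>

definition node :: "4 \<Rightarrow> 4 \<Rightarrow> coeffs" where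
  "node k l = (if k = 0 then Coeffs 1 (chi l 1) (chi l 2) (chi l 3) 0
    else Coeffs 0 (if k = 1 then 2 else 0) (if k = 2 then 2 else 0) (if k = 3 then 2 else 0)
      (2 * (if k = 1 then chi l 2 else chi l 1)))"

text \<open>The third point in which the line through \<open>w\<close> and a node \<open>n\<close> meets the Segre cubic.\<close>

definition residual :: "coeffs \<Rightarrow> coeffs \<Rightarrow> coeffs" where
  "residual n w = Coeffs (segre_deriv n w * cA w - segre w * cA n) (segre_deriv n w * cB w - segre w * cB n)
    (segre_deriv n w * cC w - segre w * cC n) (segre_deriv n w * cD w - segre w * cD n)
    (segre_deriv n w * cE w - segre w * cE n)"

lemma quartic_node:
  assumes "(k, l) \<in> even_pairs"
  shows "quartic (node k l) v = (quad (fundamental_matrix k l) v)\<^sup>2"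
  using assms unfolding even_pairs_eq quad_fundamental_matrix sum_over_4
  by (elim insertE; simp add: quartic_def node_def g0_def g1_def g2_def g3_def g4_def chi_def klein_add_def Let_def;
      simp add: algebra_simps power2_eq_square power4_eq_xxxx)

text \<open>Taylor expansion of the cubic on the line through \<open>w\<close> and \<open>n\<close>. At a node both the value and the derivative of the cubic
  vanish, and then the right-hand side is zero.\<close>

lemma segre_on_line:
  "segre (residual n w) = segre w * (segre w * segre_deriv n w * segre_deriv w n - (segre w)\<^sup>2 * segre n)"
proof -
  have taylor: "segre (Coeffs (s * cA w - t * cA n) (s * cB w - t * cB n) (s * cC w - t * cC n)
      (s * cD w - t * cD n) (s * cE w - t * cE n))
    = s^3 * segre w - s\<^sup>2 * t * segre_deriv n w + s * t\<^sup>2 * segre_deriv w n - t^3 * segre n" for s t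
    by (simp add: segre_def segre_deriv_def algebra_simps power2_eq_square power3_eq_cube)
  show ?thesis unfolding residual_def taylor
    by (simp add: algebra_simps power2_eq_square power3_eq_cube)
qed

lemma segre_node: "segre (node k l) = 0" if "(k, l) \<in> even_pairs"
  using that unfolding even_pairs_eq
  by (elim insertE; simp add: segre_def node_def chi_def)

lemma segre_deriv_node: "segre_deriv w (node k l) = 0" if "(k, l) \<in> even_pairs"
  using that unfolding even_pairs_eq
  by (elim insertE; simp add: segre_deriv_def node_def chi_def)

lemma segre_residual:
  assumes "(k, l) \<in> even_pairs"
  shows "segre (residual (node k l) w) = 0"
  using assms by (simp add: segre_on_line segre_node segre_deriv_node)

lemma quartic_residual:
  "segre_deriv n w * quartic w v = quartic (residual n w) v + segre w * quartic n v"
  by (simp add: quartic_def residual_def algebra_simps)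

section \<open>Tropes of a Kummer surface\<close>

text \<open>A point \<open>(A, b, c, d, E)\<close> of the Segre cubic in its trigonometric parametrization, with \<open>a0, ..., a3\<close> the coordinates of a
  trope and \<open>c0, ..., c3\<close> the coefficients of the quadric whose square is the Kummer equation in that trope. It is kept as a
  predicate on scalars because permutations of the last three indices act on it.\<close>

definition angle_data where
  "angle_data A b c d E a0 a1 a2 a3 c0 c1 c2 c3 \<longleftrightarrow> (\<exists>x y z :: complex.
     A * cos (2 * x) = b \<and> A * cos (2 * y) = c \<and> A * cos (2 * z) = d \<and>
     c0 = cos (x + y + z) \<and> c1 = cos (x - y - z) \<and> c2 = cos (- x + y - z) \<and> c3 = cos (- x - y + z) \<and>
     a0\<^sup>2 = sin (x + y + z) \<and> a1\<^sup>2 = sin (x - y - z) \<and> a2\<^sup>2 = sin (- x + y - z) \<and> a3\<^sup>2 = sin (- x - y + z) \<and>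
     2 * A * (a0 * a1 * a2 * a3) = E)"

definition kummer_trope :: "coeffs \<Rightarrow> complex ^ 4 \<Rightarrow> complex ^ 4 \<Rightarrow> bool" where
  "kummer_trope w a c \<longleftrightarrow>
     angle_data (cA w) (cB w) (cC w) (cD w) (cE w) (a $ 0) (a $ 1) (a $ 2) (a $ 3) (c $ 0) (c $ 1) (c $ 2) (c $ 3)"

text \<open>Complex cosines are surjective, so \<open>x\<close>, \<open>y\<close>, \<open>z\<close> exist. The equation of the cubic determines the product of the \<open>a i\<close> up to
  sign, and the sign of one square root is then adjusted.\<close>

lemma ex_kummer_trope:
  assumes S: "segre w = 0" and A: "cA w \<noteq> 0"
  shows "\<exists>a c. kummer_trope w a c"
proof -
  define x where "x = Arccos (cB w / cA w) / 2"
  define y where "y = Arccos (cC w / cA w) / 2"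
  define z where "z = Arccos (cD w / cA w) / 2"
  have xyz: "cA w * cos (2 * x) = cB w" "cA w * cos (2 * y) = cC w" "cA w * cos (2 * z) = cD w"
    using A by (simp_all add: x_def y_def z_def)
  define p0 where "p0 = csqrt (sin (x + y + z))"
  define p1 where "p1 = csqrt (sin (x - y - z))"
  define p2 where "p2 = csqrt (sin (- x + y - z))"
  define p3 where "p3 = csqrt (sin (- x - y + z))"
  have p: "p0\<^sup>2 = sin (x + y + z)" "p1\<^sup>2 = sin (x - y - z)" "p2\<^sup>2 = sin (- x + y - z)" "p3\<^sup>2 = sin (- x - y + z)"
    by (simp_all add: p0_def p1_def p2_def p3_def)
  have "cA w * (2 * cA w * (p0 * p1 * p2 * p3))\<^sup>2 = cA w ^ 3 * (4 * (p0\<^sup>2 * p1\<^sup>2 * p2\<^sup>2 * p3\<^sup>2))"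
    by (simp add: power_mult_distrib power2_eq_square power3_eq_cube)
  also have "\<dots> = cA w ^ 3 * ((cos (2 * x))\<^sup>2 + (cos (2 * y))\<^sup>2 + (cos (2 * z))\<^sup>2 - 1
      - 2 * cos (2 * x) * cos (2 * y) * cos (2 * z))"
    unfolding p sin_product ..
  also have "\<dots> = cA w * (cE w)\<^sup>2 - segre w"
    unfolding segre_def xyz[symmetric] by (simp add: algebra_simps power2_eq_square power3_eq_cube)
  finally have "(2 * cA w * (p0 * p1 * p2 * p3))\<^sup>2 = (cE w)\<^sup>2" using S A by simp
  then consider "2 * cA w * (p0 * p1 * p2 * p3) = cE w" | "2 * cA w * (- p0 * p1 * p2 * p3) = cE w"
    by (auto simp: power2_eq_iff)
  then obtain e where e: "e\<^sup>2 = p0\<^sup>2" "2 * cA w * (e * p1 * p2 * p3) = cE w"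
    by cases (metis, metis power2_minus)
  define a :: "complex ^ 4" where "a = (\<chi> i. if i = 0 then e else if i = 1 then p1 else if i = 2 then p2 else p3)"
  define c :: "complex ^ 4" where "c = (\<chi> i. if i = 0 then cos (x + y + z) else if i = 1 then cos (x - y - z)
    else if i = 2 then cos (- x + y - z) else cos (- x - y + z))"
  have "kummer_trope w a c"
    unfolding kummer_trope_def angle_data_def
    by (intro exI[of _ x] exI[of _ y] exI[of _ z]) (use xyz p e in \<open>simp add: a_def c_def\<close>)
  then show ?thesis by blast
qed

text \<open>A translation by the Klein group permutes the four angles in the same way as changing the signs of two of \<open>x\<close>, \<open>y\<close>, \<open>z\<close>,
  which does not affect \<open>cos 2x\<close>, \<open>cos 2y\<close>, \<open>cos 2z\<close>. A character changes an even number of signs of the \<open>a i\<close>.\<close>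

lemma kummer_trope_heisenberg:
  assumes "kummer_trope w a c"
  shows "kummer_trope w (heisenberg_action k l a) (heisenberg_action k 0 c)"
proof -
  obtain x y z where xyz: "cA w * cos (2 * x) = cB w" "cA w * cos (2 * y) = cC w" "cA w * cos (2 * z) = cD w"
    and c: "c $ 0 = cos (x + y + z)" "c $ 1 = cos (x - y - z)" "c $ 2 = cos (- x + y - z)" "c $ 3 = cos (- x - y + z)"
    and a: "(a $ 0)\<^sup>2 = sin (x + y + z)" "(a $ 1)\<^sup>2 = sin (x - y - z)"
      "(a $ 2)\<^sup>2 = sin (- x + y - z)" "(a $ 3)\<^sup>2 = sin (- x - y + z)"
    and E: "2 * cA w * (a $ 0 * a $ 1 * a $ 2 * a $ 3) = cE w"
    using assms unfolding kummer_trope_def angle_data_def by blast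
  have sq: "(heisenberg_action k l a $ i)\<^sup>2 = (a $ klein_add k i)\<^sup>2" "heisenberg_action k 0 c $ i = c $ klein_add k i" for i
    by (auto simp: heisenberg_action_def power_mult_distrib chi_def)
  have "heisenberg_action k l a $ 0 * heisenberg_action k l a $ 1 * heisenberg_action k l a $ 2 * heisenberg_action k l a $ 3 = a $ 0 * a $ 1 * a $ 2 * a $ 3"
    by (cases k rule: cases_4; cases l rule: cases_4) (simp_all add: heisenberg_action_def chi_def klein_add_def mult_ac)
  then have E': "2 * cA w * (heisenberg_action k l a $ 0 * heisenberg_action k l a $ 1 * heisenberg_action k l a $ 2 * heisenberg_action k l a $ 3) = cE w"
    using E by simp
  consider "k = 0" | "k = 1" | "k = 2" | "k = 3" by (cases k rule: cases_4)
  then show ?thesis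
  proof cases
    case 1
    show ?thesis unfolding kummer_trope_def angle_data_def sq
      by (intro exI[of _ x] exI[of _ y] exI[of _ z]) (use xyz c a E' in \<open>simp add: klein_add_def 1\<close>)
  next
    case 2
    show ?thesis unfolding kummer_trope_def angle_data_def sq
      by (intro exI[of _ x] exI[of _ "- y"] exI[of _ "- z"]) (use xyz c a E' in \<open>simp add: klein_add_def 2\<close>)
  next
    case 3
    show ?thesis unfolding kummer_trope_def angle_data_def sq
      by (intro exI[of _ "- x"] exI[of _ y] exI[of _ "- z"]) (use xyz c a E' in \<open>simp add: klein_add_def 3\<close>)
  next
    case 4
    show ?thesis unfolding kummer_trope_def angle_data_def sq
      by (intro exI[of _ "- x"] exI[of _ "- y"] exI[of _ z]) (use xyz c a E' in \<open>simp add: klein_add_def 4\<close>)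
  qed
qed

text \<open>Exchanging \<open>x\<close> with \<open>y\<close> exchanges the second and third angle. This reduces statements on the partitions \<open>{0,2}, {1,3}\<close> and
  \<open>{0,3}, {1,2}\<close> of the indices to the partition \<open>{0,1}, {2,3}\<close>.\<close>

lemma angle_data_permute:
  assumes "angle_data A b c d E a0 a1 a2 a3 c0 c1 c2 c3"
  shows "angle_data A c b d E a0 a2 a1 a3 c0 c2 c1 c3" "angle_data A d b c E a0 a3 a1 a2 c0 c3 c1 c2"
proof -
  obtain x y z where *: "A * cos (2 * x) = b" "A * cos (2 * y) = c" "A * cos (2 * z) = d"
     "c0 = cos (x + y + z)" "c1 = cos (x - y - z)" "c2 = cos (- x + y - z)" "c3 = cos (- x - y + z)"
     "a0\<^sup>2 = sin (x + y + z)" "a1\<^sup>2 = sin (x - y - z)" "a2\<^sup>2 = sin (- x + y - z)" "a3\<^sup>2 = sin (- x - y + z)"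
     "2 * A * (a0 * a1 * a2 * a3) = E"
    using assms unfolding angle_data_def by blast
  have e: "y + x + z = x + y + z" "y - x - z = - x + y - z" "- y + x - z = x - y - z" "- y - x + z = - x - y + z"
    "z + x + y = x + y + z" "z - x - y = - x - y + z" "- z + x - y = x - y - z" "- z - x + y = - x + y - z"
    by simp_all
  have E: "2 * A * (a0 * a2 * a1 * a3) = E" "2 * A * (a0 * a3 * a1 * a2) = E"
    using *(12) by (simp_all add: mult_ac)
  show "angle_data A c b d E a0 a2 a1 a3 c0 c2 c1 c3"
    unfolding angle_data_def by (intro exI[of _ y] exI[of _ x] exI[of _ z]) (simp only: e * E)
  show "angle_data A d b c E a0 a3 a1 a2 c0 c3 c1 c2"
    unfolding angle_data_def by (intro exI[of _ z] exI[of _ x] exI[of _ y]) (simp only: e * E)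
qed

lemma angle_data_relations:
  assumes "angle_data A b c d E a0 a1 a2 a3 c0 c1 c2 c3"
  shows "c0\<^sup>2 + a0^4 = 1" "c1\<^sup>2 + a1^4 = 1" "c2\<^sup>2 + a2^4 = 1" "c3\<^sup>2 + a3^4 = 1"
    and "A * (c0 * c1 - a0\<^sup>2 * a1\<^sup>2) = b" "A * (c2 * c3 - a2\<^sup>2 * a3\<^sup>2) = b"
    and "2 * A * (a0 * a1 * a2 * a3) = E"
    and "A\<^sup>2 * (a0\<^sup>2 * a1\<^sup>2 + a2\<^sup>2 * a3\<^sup>2) = c * d - A * b"
proof -
  obtain x y z where *: "A * cos (2 * x) = b" "A * cos (2 * y) = c" "A * cos (2 * z) = d"
     "c0 = cos (x + y + z)" "c1 = cos (x - y - z)" "c2 = cos (- x + y - z)" "c3 = cos (- x - y + z)"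
     "a0\<^sup>2 = sin (x + y + z)" "a1\<^sup>2 = sin (x - y - z)" "a2\<^sup>2 = sin (- x + y - z)" "a3\<^sup>2 = sin (- x - y + z)"
     "2 * A * (a0 * a1 * a2 * a3) = E"
    using assms unfolding angle_data_def by blast
  have "p ^ 4 = (p\<^sup>2)\<^sup>2" for p :: complex by simp
  then show "c0\<^sup>2 + a0^4 = 1" "c1\<^sup>2 + a1^4 = 1" "c2\<^sup>2 + a2^4 = 1" "c3\<^sup>2 + a3^4 = 1"
    by (simp_all only: * sin_cos_squared_add2)
  show "A * (c0 * c1 - a0\<^sup>2 * a1\<^sup>2) = b" "A * (c2 * c3 - a2\<^sup>2 * a3\<^sup>2) = b"
    unfolding * sin_pair_products using *(1) by (simp_all add: field_simps)
  show "2 * A * (a0 * a1 * a2 * a3) = E" by (fact *(12))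
  show "A\<^sup>2 * (a0\<^sup>2 * a1\<^sup>2 + a2\<^sup>2 * a3\<^sup>2) = c * d - A * b"
    unfolding * sin_pair_sum unfolding *(1-3)[symmetric] by (simp add: algebra_simps power2_eq_square)
qed

text \<open>The two angles of the pair \<open>{0,1}\<close> add up to \<open>2 x\<close>, those of \<open>{2,3}\<close> to \<open>- 2 x\<close>.\<close>

lemma angle_data_sines:
  assumes "angle_data A b c d E a0 a1 a2 a3 c0 c1 c2 c3"
  obtains \<sigma> where "a0\<^sup>2 * c1 + a1\<^sup>2 * c0 = \<sigma>" "a2\<^sup>2 * c3 + a3\<^sup>2 * c2 = - \<sigma>" "A\<^sup>2 * \<sigma>\<^sup>2 = A\<^sup>2 - b\<^sup>2"
proof -
  obtain x y z where *: "A * cos (2 * x) = b" "A * cos (2 * y) = c" "A * cos (2 * z) = d"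
     "c0 = cos (x + y + z)" "c1 = cos (x - y - z)" "c2 = cos (- x + y - z)" "c3 = cos (- x - y + z)"
     "a0\<^sup>2 = sin (x + y + z)" "a1\<^sup>2 = sin (x - y - z)" "a2\<^sup>2 = sin (- x + y - z)" "a3\<^sup>2 = sin (- x - y + z)"
    using assms unfolding angle_data_def by blast
  have h: "sin p * cos q + sin q * cos p = sin (p + q)" for p q :: complex
    by (simp add: sin_add)
  have "a0\<^sup>2 * c1 + a1\<^sup>2 * c0 = sin (2 * x)" "a2\<^sup>2 * c3 + a3\<^sup>2 * c2 = - sin (2 * x)"
    unfolding * h by (simp_all add: algebra_simps)
  moreover have "A\<^sup>2 * (sin (2 * x))\<^sup>2 = A\<^sup>2 - b\<^sup>2"
    unfolding *(1)[symmetric] sin_squared_eq by (simp add: algebra_simps power2_eq_square)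
  ultimately show ?thesis by (rule that)
qed

text \<open>The difference of the two products is the sine of a difference of angles, \<open>2 y + 2 z\<close> or \<open>2 y - 2 z\<close>.\<close>

lemma angle_data_independent:
  assumes "angle_data A b c d E a0 a1 a2 a3 c0 c1 c2 c3" and "A \<noteq> 0" "c\<^sup>2 \<noteq> d\<^sup>2"
  shows "a0\<^sup>2 * c1 \<noteq> a1\<^sup>2 * c0" "a2\<^sup>2 * c3 \<noteq> a3\<^sup>2 * c2"
proof -
  obtain x y z where *: "A * cos (2 * x) = b" "A * cos (2 * y) = c" "A * cos (2 * z) = d"
     "c0 = cos (x + y + z)" "c1 = cos (x - y - z)" "c2 = cos (- x + y - z)" "c3 = cos (- x - y + z)"
     "a0\<^sup>2 = sin (x + y + z)" "a1\<^sup>2 = sin (x - y - z)" "a2\<^sup>2 = sin (- x + y - z)" "a3\<^sup>2 = sin (- x - y + z)"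
    using assms unfolding angle_data_def by blast
  have h: "sin p * cos q - sin q * cos p = sin (p - q)" for p q :: complex
    by (simp add: sin_diff)
  have e: "x + y + z - (x - y - z) = 2 * y + 2 * z" "- x + y - z - (- x - y + z) = 2 * y - 2 * z"
    by simp_all
  have "a0\<^sup>2 * c1 - a1\<^sup>2 * c0 \<noteq> 0" "a2\<^sup>2 * c3 - a3\<^sup>2 * c2 \<noteq> 0"
    unfolding * h e using sin_add_nonzero[OF assms(2) *(2,3) assms(3)] by simp_all
  then show "a0\<^sup>2 * c1 \<noteq> a1\<^sup>2 * c0" "a2\<^sup>2 * c3 \<noteq> a3\<^sup>2 * c2" by simp_all
qed

lemma angle_data_fourth_powers:
  assumes ad: "angle_data A b c d E a0 a1 a2 a3 c0 c1 c2 c3" and "A \<noteq> 0" "c\<^sup>2 \<noteq> d\<^sup>2" "b\<^sup>2 \<noteq> A\<^sup>2"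
  shows "a0^4 \<noteq> a1^4" "a2^4 \<noteq> a3^4"
proof -
  obtain \<sigma> where \<sigma>: "a0\<^sup>2 * c1 + a1\<^sup>2 * c0 = \<sigma>" "a2\<^sup>2 * c3 + a3\<^sup>2 * c2 = - \<sigma>" "A\<^sup>2 * \<sigma>\<^sup>2 = A\<^sup>2 - b\<^sup>2"
    using angle_data_sines[OF ad] .
  have "\<sigma> \<noteq> 0" using \<sigma>(3) assms(2,4) by auto
  note sq = angle_data_relations(1-4)[OF ad]
  have "a0^4 - a1^4 = (a0\<^sup>2 * c1 - a1\<^sup>2 * c0) * \<sigma>" "a2^4 - a3^4 = - (a2\<^sup>2 * c3 - a3\<^sup>2 * c2) * \<sigma>"
    using sq \<sigma>(1,2) by algebra+
  then show "a0^4 \<noteq> a1^4" "a2^4 \<noteq> a3^4"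
    using angle_data_independent[OF ad assms(2,3)] \<open>\<sigma> \<noteq> 0\<close> by auto
qed

text \<open>Comparing coefficients, \<open>c\<^sub>i\<^sup>2 + a\<^sub>i\<^sup>4 = 1\<close> gives the fourth powers, the addition theorem for the cosine gives the terms
  \<open>v\<^sub>i\<^sup>2 v\<^sub>j\<^sup>2\<close>, and the term \<open>v\<^sub>0 v\<^sub>1 v\<^sub>2 v\<^sub>3\<close> comes from the product of linear forms only.\<close>

lemma quartic_kummer:
  assumes "kummer_trope w a c"
  shows "quartic w v = cA w * ((\<Sum>i\<in>UNIV. c $ i * (v $ i)\<^sup>2)\<^sup>2
    + dot a v * dot (heisenberg_action 0 1 a) v * dot (heisenberg_action 0 2 a) v * dot (heisenberg_action 0 3 a) v)"
proof -
  define x y z u where xyz: "x = v $ 0" "y = v $ 1" "z = v $ 2" "u = v $ 3"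
  define a0 a1 a2 a3 c0 c1 c2 c3 where ac: "a0 = a $ 0" "a1 = a $ 1" "a2 = a $ 2" "a3 = a $ 3"
    "c0 = c $ 0" "c1 = c $ 1" "c2 = c $ 2" "c3 = c $ 3"
  define A where "A = cA w"
  have ad: "angle_data A (cB w) (cC w) (cD w) (cE w) a0 a1 a2 a3 c0 c1 c2 c3"
    using assms unfolding kummer_trope_def ac A_def .
  note r1 = angle_data_relations[OF ad] and r2 = angle_data_relations(5,6)[OF angle_data_permute(1)[OF ad]]
    and r3 = angle_data_relations(5,6)[OF angle_data_permute(2)[OF ad]]
  have "quartic w v = A * 1 * x^4 + A * 1 * y^4 + A * 1 * z^4 + A * 1 * u^4
      + 2 * (cB w * (x\<^sup>2 * y\<^sup>2) + cB w * (z\<^sup>2 * u\<^sup>2) + cC w * (x\<^sup>2 * z\<^sup>2) + cC w * (y\<^sup>2 * u\<^sup>2)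
        + cD w * (x\<^sup>2 * u\<^sup>2) + cD w * (y\<^sup>2 * z\<^sup>2)) + 4 * cE w * x * y * z * u"
    unfolding quartic_def g0_def g1_def g2_def g3_def g4_def Let_def xyz A_def by (simp add: algebra_simps)
  also have "\<dots> = A * (c0\<^sup>2 + a0^4) * x^4 + A * (c1\<^sup>2 + a1^4) * y^4 + A * (c2\<^sup>2 + a2^4) * z^4 + A * (c3\<^sup>2 + a3^4) * u^4
      + 2 * (A * (c0 * c1 - a0\<^sup>2 * a1\<^sup>2) * (x\<^sup>2 * y\<^sup>2) + A * (c2 * c3 - a2\<^sup>2 * a3\<^sup>2) * (z\<^sup>2 * u\<^sup>2)
        + A * (c0 * c2 - a0\<^sup>2 * a2\<^sup>2) * (x\<^sup>2 * z\<^sup>2) + A * (c1 * c3 - a1\<^sup>2 * a3\<^sup>2) * (y\<^sup>2 * u\<^sup>2)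
        + A * (c0 * c3 - a0\<^sup>2 * a3\<^sup>2) * (x\<^sup>2 * u\<^sup>2) + A * (c1 * c2 - a1\<^sup>2 * a2\<^sup>2) * (y\<^sup>2 * z\<^sup>2))
      + 4 * (2 * A * (a0 * a1 * a2 * a3)) * x * y * z * u"
    unfolding r1(1-7) r2 r3 ..
  also have "\<dots> = A * ((c0 * x\<^sup>2 + c1 * y\<^sup>2 + c2 * z\<^sup>2 + c3 * u\<^sup>2)\<^sup>2
      + (a0 * x + a1 * y + a2 * z + a3 * u) * (a0 * x + a1 * y - a2 * z - a3 * u)
        * (a0 * x - a1 * y + a2 * z - a3 * u) * (a0 * x - a1 * y - a2 * z + a3 * u))"
    by (simp add: algebra_simps power2_eq_square power4_eq_xxxx)
  finally show ?thesis
    by (simp add: sum_over_4 dot_def heisenberg_action_def chi_def klein_add_def ac xyz A_def)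
qed

section \<open>The conics in a trope\<close>

text \<open>The matrix of \<open>r \<phi> + t Q\<close>.\<close>

definition conic_matrix :: "complex ^ 4 \<Rightarrow> complex \<Rightarrow> complex \<Rightarrow> 4 \<Rightarrow> 4 \<Rightarrow> complex ^ 4 ^ 4" where
  "conic_matrix c r t k l = (\<chi> i j. (if i = j then r * c $ i else 0) + t * fundamental_matrix k l $ i $ j)"

lemma conic_matrix_mult: "(conic_matrix c r t k l *v v) $ i = r * (c $ i * v $ i) + t * (fundamental_matrix k l *v v) $ i"
proof -
  have "(conic_matrix c r t k l *v v) $ i
      = (\<Sum>j\<in>UNIV. (if i = j then r * c $ i * v $ j else 0) + t * (fundamental_matrix k l $ i $ j * v $ j))"
    unfolding conic_matrix_def matrix_vector_mult_def
    by (simp, rule sum.cong) (auto simp: algebra_simps)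
  also have "\<dots> = r * (c $ i * v $ i) + t * (fundamental_matrix k l *v v) $ i"
    by (simp add: sum.distrib matrix_vector_mult_def sum_distrib_left)
  finally show ?thesis .
qed

lemma quad_conic_matrix:
  "quad (conic_matrix c r t k l) v = r * (\<Sum>i\<in>UNIV. c $ i * (v $ i)\<^sup>2) + t * quad (fundamental_matrix k l) v"
  unfolding quad_def dot_def conic_matrix_mult
  by (simp add: sum.distrib sum_distrib_left algebra_simps power2_eq_square)

lemma transpose_conic_matrix:
  assumes "(k, l) \<in> even_pairs"
  shows "transpose (conic_matrix c r t k l) = conic_matrix c r t k l"
proof -
  have "fundamental_matrix k l $ i $ j = fundamental_matrix k l $ j $ i" for i j
    using arg_cong[OF transpose_fundamental_matrix[OF assms], of "\<lambda>M. M $ i $ j"] by (simp add: transpose_def)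
  then show ?thesis by (simp add: transpose_def conic_matrix_def vec_eq_iff)
qed

text \<open>The bordered determinants of the two conics in a trope, for a diagonal fundamental quadric, have this expression as their
  product, up to a constant and the factor \<open>(sin x sin y sin z)\<^sup>2\<close>.\<close>

definition diag_disc where
  "diag_disc A b c d S = 2 * (A + b) * (A + c) * (A + d) + S * (3 * A + b + c + d + 2 * S)\<^sup>2"

text \<open>The analogue of \<open>diag_disc\<close> for the other six quadrics. The first factor is, up to a constant, \<open>A\<^sup>2\<close> times the square of
  the discriminant of the fundamental quadric in the trope; the second is the product of the remaining factors of the two
  bordered determinants, up to a power of \<open>A\<close>.\<close>

definition pair_disc where
  "pair_disc A b c d E e S = (c * d - A * b + e * A * E) *
     ((A\<^sup>2 - b\<^sup>2) * (c * d - A * b - e * A * E) + A * S * (2 * b + e * E + 2 * S)\<^sup>2)"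

definition conic_disc :: "4 \<Rightarrow> 4 \<Rightarrow> coeffs \<Rightarrow> complex \<Rightarrow> complex" where
  "conic_disc k l w S =
    (if k = 0 then diag_disc (cA w) (chi l 1 * cB w) (chi l 2 * cC w) (chi l 3 * cD w) S
     else if k = 1 then pair_disc (cA w) (cB w) (cC w) (cD w) (cE w) (chi l 2) S
     else if k = 2 then pair_disc (cA w) (cC w) (cB w) (cD w) (cE w) (chi l 1) S
     else pair_disc (cA w) (cD w) (cB w) (cC w) (cE w) (chi l 1) S)"

text \<open>The left-hand side of the first assumption is the bordered determinant up to sign; combining the equations with
  cofactors shows that its product with \<open>\<mu>\<close> is zero, and then its product with each \<open>v\<^sub>i\<close>.\<close>

lemma diagonal_nondegenerate:
  fixes m0 :: complex
  assumes "a0\<^sup>2 * (m1 * m2 * m3) + a1\<^sup>2 * (m0 * m2 * m3) + a2\<^sup>2 * (m0 * m1 * m3) + a3\<^sup>2 * (m0 * m1 * m2) \<noteq> 0"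
    and eqs: "m0 * v0 = \<mu> * a0" "m1 * v1 = \<mu> * a1" "m2 * v2 = \<mu> * a2" "m3 * v3 = \<mu> * a3"
    and plane: "a0 * v0 + a1 * v1 + a2 * v2 + a3 * v3 = 0"
  shows "v0 = 0 \<and> v1 = 0 \<and> v2 = 0 \<and> v3 = 0"
proof -
  define D where "D = a0\<^sup>2 * (m1 * m2 * m3) + a1\<^sup>2 * (m0 * m2 * m3) + a2\<^sup>2 * (m0 * m1 * m3) + a3\<^sup>2 * (m0 * m1 * m2)"
  have "\<mu> * D = 0" unfolding D_def using eqs plane by algebra
  then have "\<mu> = 0" using assms(1) D_def by simp
  with eqs have "m0 * v0 = 0" "m1 * v1 = 0" "m2 * v2 = 0" "m3 * v3 = 0" by auto
  with plane have "D * v0 = 0" "D * v1 = 0" "D * v2 = 0" "D * v3 = 0"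
    unfolding D_def by algebra+
  then show ?thesis using assms(1) D_def by simp
qed

lemma paired_nondegenerate:
  fixes m0 :: complex
  assumes "(a0\<^sup>2 * m1 - 2 * a0 * a1 * s + a1\<^sup>2 * m0) * (m2 * m3 - t\<^sup>2)
      + (a2\<^sup>2 * m3 - 2 * a2 * a3 * t + a3\<^sup>2 * m2) * (m0 * m1 - s\<^sup>2) \<noteq> 0"
    and eqs: "m0 * v0 + s * v1 = \<mu> * a0" "m1 * v1 + s * v0 = \<mu> * a1"
      "m2 * v2 + t * v3 = \<mu> * a2" "m3 * v3 + t * v2 = \<mu> * a3"
    and plane: "a0 * v0 + a1 * v1 + a2 * v2 + a3 * v3 = 0"
  shows "v0 = 0 \<and> v1 = 0 \<and> v2 = 0 \<and> v3 = 0"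
proof -
  define D where "D = (a0\<^sup>2 * m1 - 2 * a0 * a1 * s + a1\<^sup>2 * m0) * (m2 * m3 - t\<^sup>2)
      + (a2\<^sup>2 * m3 - 2 * a2 * a3 * t + a3\<^sup>2 * m2) * (m0 * m1 - s\<^sup>2)"
  have "\<mu> * D = 0" unfolding D_def using eqs plane by algebra
  then have "\<mu> = 0" using assms(1) D_def by simp
  with eqs have "m0 * v0 + s * v1 = 0" "m1 * v1 + s * v0 = 0" "m2 * v2 + t * v3 = 0" "m3 * v3 + t * v2 = 0"
    by auto
  with plane have "D * v0 = 0" "D * v1 = 0" "D * v2 = 0" "D * v3 = 0"
    unfolding D_def by algebra+
  then show ?thesis using assms(1) D_def by simp
qed

text \<open>Put \<open>\<alpha> = a0 a1\<close>, \<open>\<beta> = a2 a3\<close>. The determinant factors as \<open>\<alpha> + e \<beta>\<close> times a binomial \<open>G\<close> whose two terms have rational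
  squares, because \<open>\<alpha>\<^sup>2 + \<beta>\<^sup>2\<close>, \<open>\<alpha> \<beta>\<close> and the square of the sine \<open>\<sigma>\<close> are rational in the coefficients.\<close>

lemma paired_det_nonzero:
  assumes ad: "angle_data A b c d E a0 a1 a2 a3 c0 c1 c2 c3" and "A \<noteq> 0"
    and r: "r\<^sup>2 = A" and s: "s\<^sup>2 = - S" and e: "e\<^sup>2 = 1" and disc: "pair_disc A b c d E e S \<noteq> 0"
  shows "(a0\<^sup>2 * (r * c1) - 2 * a0 * a1 * s + a1\<^sup>2 * (r * c0)) * (r * c2 * (r * c3) - (e * s)\<^sup>2)
      + (a2\<^sup>2 * (r * c3) - 2 * a2 * a3 * (e * s) + a3\<^sup>2 * (r * c2)) * (r * c0 * (r * c1) - s\<^sup>2) \<noteq> 0"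
    (is "?D \<noteq> 0") and "a0 * a1 + e * (a2 * a3) \<noteq> 0"
proof -
  define \<alpha> where "\<alpha> = a0 * a1"
  define \<beta> where "\<beta> = a2 * a3"
  obtain \<sigma> where \<sigma>: "a0\<^sup>2 * c1 + a1\<^sup>2 * c0 = \<sigma>" "a2\<^sup>2 * c3 + a3\<^sup>2 * c2 = - \<sigma>" "A\<^sup>2 * \<sigma>\<^sup>2 = A\<^sup>2 - b\<^sup>2"
    using angle_data_sines[OF ad] .
  note rel = angle_data_relations[OF ad]
  have E: "2 * A * \<alpha> * \<beta> = E" using rel(7) by (simp add: \<alpha>_def \<beta>_def mult_ac)
  have inv: "A\<^sup>2 * (\<alpha>\<^sup>2 + \<beta>\<^sup>2) = c * d - A * b" using rel(8) by (simp add: \<alpha>_def \<beta>_def power_mult_distrib)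
  have cc: "A * (c0 * c1) = b + A * \<alpha>\<^sup>2" "A * (c2 * c3) = b + A * \<beta>\<^sup>2"
    using rel(5,6) by (simp_all add: \<alpha>_def \<beta>_def algebra_simps)
  have plus: "A\<^sup>2 * (\<alpha> + e * \<beta>)\<^sup>2 = c * d - A * b + e * A * E"
    using inv E e by algebra
  have minus: "A\<^sup>2 * (e * \<beta> - \<alpha>)\<^sup>2 = c * d - A * b - e * A * E"
    using inv E e by algebra
  have nz: "\<alpha> + e * \<beta> \<noteq> 0"
    using disc plus unfolding pair_disc_def by auto
  then show "a0 * a1 + e * (a2 * a3) \<noteq> 0" by (simp add: \<alpha>_def \<beta>_def)
  define G where "G = r * A * \<sigma> * (e * \<beta> - \<alpha>) - s * (2 * b + e * E + 2 * S)"
  have "?D = (r * \<sigma> - 2 * \<alpha> * s) * (A * (c2 * c3) - s\<^sup>2) + (- r * \<sigma> - 2 * \<beta> * (e * s)) * (A * (c0 * c1) - s\<^sup>2)"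
  proof -
    have "a0\<^sup>2 * (r * c1) - 2 * a0 * a1 * s + a1\<^sup>2 * (r * c0) = r * \<sigma> - 2 * \<alpha> * s"
      unfolding \<sigma>(1)[symmetric] \<alpha>_def by (simp add: algebra_simps)
    moreover have "a2\<^sup>2 * (r * c3) - 2 * a2 * a3 * (e * s) + a3\<^sup>2 * (r * c2) = r * (- \<sigma>) - 2 * \<beta> * (e * s)"
      unfolding \<sigma>(2)[symmetric] \<beta>_def by (simp add: algebra_simps)
    moreover have "r * c2 * (r * c3) - (e * s)\<^sup>2 = A * (c2 * c3) - s\<^sup>2" "r * c0 * (r * c1) = A * (c0 * c1)"
      using e unfolding r[symmetric] power_mult_distrib by (simp_all add: power2_eq_square mult_ac)
    ultimately show ?thesis by simp
  qed
  also have "\<dots> = (\<alpha> + e * \<beta>) * G"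
    unfolding cc G_def using s E e by algebra
  finally have D: "?D = (\<alpha> + e * \<beta>) * G" .
  have "G \<noteq> 0"
  proof
    assume "G = 0"
    then have "(r * A * \<sigma> * (e * \<beta> - \<alpha>))\<^sup>2 = (s * (2 * b + e * E + 2 * S))\<^sup>2"
      by (simp add: G_def)
    then have sq: "A * ((A\<^sup>2 * \<sigma>\<^sup>2) * (A\<^sup>2 * (e * \<beta> - \<alpha>)\<^sup>2)) = A\<^sup>2 * (- S * (2 * b + e * E + 2 * S)\<^sup>2)"
      using r s by algebra
    have "A * ((A\<^sup>2 - b\<^sup>2) * (c * d - A * b - e * A * E)) = A * (- A * S * (2 * b + e * E + 2 * S)\<^sup>2)"
      using sq unfolding \<sigma>(3) minus by (simp add: power2_eq_square mult_ac)
    then have "(A\<^sup>2 - b\<^sup>2) * (c * d - A * b - e * A * E) = - A * S * (2 * b + e * E + 2 * S)\<^sup>2"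
      by (rule iffD1[OF mult_left_cancel[OF \<open>A \<noteq> 0\<close>]])
    then show False using disc unfolding pair_disc_def by simp
  qed
  with nz D show "?D \<noteq> 0" by simp
qed

text \<open>Shifting two of the three parameters by a quarter turn, in opposite directions, shifts two of the four angles by half a turn.
  This absorbs the signs of a diagonal fundamental quadric into the angles.\<close>

lemma angle_data_shift:
  assumes "angle_data A b c d E a0 a1 a2 a3 c0 c1 c2 c3"
  obtains x y z where "A * cos (2 * x) = chi l 1 * b" "A * cos (2 * y) = chi l 2 * c" "A * cos (2 * z) = chi l 3 * d"
     "c0 = cos (x + y + z)" "c1 = chi l 1 * cos (x - y - z)" "c2 = chi l 2 * cos (- x + y - z)" "c3 = chi l 3 * cos (- x - y + z)"
     "a0\<^sup>2 = sin (x + y + z)" "a1\<^sup>2 = chi l 1 * sin (x - y - z)" "a2\<^sup>2 = chi l 2 * sin (- x + y - z)"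
     "a3\<^sup>2 = chi l 3 * sin (- x - y + z)"
proof -
  obtain x y z where *: "A * cos (2 * x) = b" "A * cos (2 * y) = c" "A * cos (2 * z) = d"
     "c0 = cos (x + y + z)" "c1 = cos (x - y - z)" "c2 = cos (- x + y - z)" "c3 = cos (- x - y + z)"
     "a0\<^sup>2 = sin (x + y + z)" "a1\<^sup>2 = sin (x - y - z)" "a2\<^sup>2 = sin (- x + y - z)" "a3\<^sup>2 = sin (- x - y + z)"
    using assms unfolding angle_data_def by blast
  define h :: complex where "h = of_real pi / 2"
  have per: "sin (p + 2 * h) = - sin p" "cos (p + 2 * h) = - cos p" "sin (p - 2 * h) = - sin p" "cos (p - 2 * h) = - cos p" for p
    by (simp_all add: h_def sin_add cos_add sin_diff cos_diff sin_of_real cos_of_real)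
  have dbl: "2 * (p + h) = 2 * p + 2 * h" "2 * (p - h) = 2 * p - 2 * h" for p by simp_all
  consider "l = 0" | "l = 1" | "l = 2" | "l = 3" by (cases l rule: cases_4)
  then show ?thesis
  proof cases
    case 1
    then show ?thesis using * by (intro that[of x y z]) (simp_all add: chi_def)
  next
    case 2
    have e: "x + (y + h) + (z - h) = x + y + z" "x - (y + h) - (z - h) = x - y - z"
      "- x + (y + h) - (z - h) = - x + y - z + 2 * h" "- x - (y + h) + (z - h) = - x - y + z - 2 * h" by simp_all
    show ?thesis by (rule that[of x "y + h" "z - h"]; (simp only: e dbl per)?) (use * in \<open>simp_all add: chi_def 2\<close>)
  next
    case 3
    have e: "x + h + y + (z - h) = x + y + z" "x + h - y - (z - h) = x - y - z + 2 * h"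
      "- (x + h) + y - (z - h) = - x + y - z" "- (x + h) - y + (z - h) = - x - y + z - 2 * h" by simp_all
    show ?thesis by (rule that[of "x + h" y "z - h"]; (simp only: e dbl per)?) (use * in \<open>simp_all add: chi_def 3\<close>)
  next
    case 4
    have e: "x + h + (y - h) + z = x + y + z" "x + h - (y - h) - z = x - y - z + 2 * h"
      "- (x + h) + (y - h) - z = - x + y - z - 2 * h" "- (x + h) - (y - h) + z = - x - y + z" by simp_all
    show ?thesis by (rule that[of "x + h" "y - h" z]; (simp only: e dbl per)?) (use * in \<open>simp_all add: chi_def 4\<close>)
  qed
qed

text \<open>The diagonal quadrics are reduced to the sum of four squares by \<open>angle_data_shift\<close>, the others to \<open>{0,1}, {2,3}\<close> by
  \<open>angle_data_permute\<close>.\<close>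

lemma conic_nondegenerate:
  assumes kt: "kummer_trope w a c" and kl: "(k, l) \<in> even_pairs" and A: "cA w \<noteq> 0"
    and sq: "(cB w)\<^sup>2 \<noteq> (cA w)\<^sup>2" "(cC w)\<^sup>2 \<noteq> (cA w)\<^sup>2" "(cD w)\<^sup>2 \<noteq> (cA w)\<^sup>2"
    and disc: "conic_disc k l w S \<noteq> 0" and r: "r\<^sup>2 = cA w" and t: "t\<^sup>2 = - S"
  shows "nondegenerate_on a (conic_matrix c r t k l)"
  unfolding nondegenerate_on_def
proof (intro allI impI)
  fix v \<mu>
  assume "dot a v = 0" and "conic_matrix c r t k l *v v = \<mu> *s a"
  then have plane: "a $ 0 * v $ 0 + a $ 1 * v $ 1 + a $ 2 * v $ 2 + a $ 3 * v $ 3 = 0"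
    and eq: "\<And>i. r * (c $ i * v $ i) + t * (chi l i * v $ klein_add k i) = \<mu> * a $ i"
    by (auto simp: dot_def sum_over_4 fundamental_matrix_mult vec_eq_iff conic_matrix_mult)
  have ad: "angle_data (cA w) (cB w) (cC w) (cD w) (cE w) (a $ 0) (a $ 1) (a $ 2) (a $ 3) (c $ 0) (c $ 1) (c $ 2) (c $ 3)"
    using kt unfolding kummer_trope_def .
  consider "k = 0" | "k = 1" "l = 0 \<or> l = 1" | "k = 2" "l = 0 \<or> l = 2" | "k = 3" "l = 0 \<or> l = 3"
    using kl unfolding even_pairs_eq by auto
  then have "v $ 0 = 0 \<and> v $ 1 = 0 \<and> v $ 2 = 0 \<and> v $ 3 = 0"
  proof cases
    case 1
    obtain x y z where xyz: "cA w * cos (2 * x) = chi l 1 * cB w" "cA w * cos (2 * y) = chi l 2 * cC w"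
      "cA w * cos (2 * z) = chi l 3 * cD w"
      and cs: "c $ 0 = cos (x + y + z)" "c $ 1 = chi l 1 * cos (x - y - z)" "c $ 2 = chi l 2 * cos (- x + y - z)"
        "c $ 3 = chi l 3 * cos (- x - y + z)"
      and sn: "(a $ 0)\<^sup>2 = sin (x + y + z)" "(a $ 1)\<^sup>2 = chi l 1 * sin (x - y - z)"
        "(a $ 2)\<^sup>2 = chi l 2 * sin (- x + y - z)" "(a $ 3)\<^sup>2 = chi l 3 * sin (- x - y + z)"
      using angle_data_shift[OF ad, of l] .
    have ne: "chi l i * p \<noteq> cA w" if "p\<^sup>2 \<noteq> (cA w)\<^sup>2" for i p
    proof
      assume "chi l i * p = cA w"
      then have "(cA w)\<^sup>2 = (chi l i * p)\<^sup>2" by simp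
      then show False using that by (simp add: power_mult_distrib)
    qed
    have nz: "sin (x + y + z) * ((r * cos (x - y - z) + t) * (r * cos (- x + y - z) + t) * (r * cos (- x - y + z) + t))
       + sin (x - y - z) * ((r * cos (x + y + z) + t) * (r * cos (- x + y - z) + t) * (r * cos (- x - y + z) + t))
       + sin (- x + y - z) * ((r * cos (x + y + z) + t) * (r * cos (x - y - z) + t) * (r * cos (- x - y + z) + t))
       + sin (- x - y + z) * ((r * cos (x + y + z) + t) * (r * cos (x - y - z) + t) * (r * cos (- x + y - z) + t)) \<noteq> 0"
      using bordered_diagonal_det_nonzero[OF xyz(1) ne[OF sq(1)] xyz(2) ne[OF sq(2)] xyz(3) ne[OF sq(3)] r t]
        disc 1 by (simp add: conic_disc_def diag_disc_def)
    show ?thesis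
    proof (rule diagonal_nondegenerate[where \<mu> = \<mu> and ?a0.0 = "a $ 0" and ?a1.0 = "a $ 1" and ?a2.0 = "a $ 2" and ?a3.0 = "a $ 3"
          and ?m0.0 = "chi l 0 * (r * cos (x + y + z) + t)" and ?m1.0 = "chi l 1 * (r * cos (x - y - z) + t)"
          and ?m2.0 = "chi l 2 * (r * cos (- x + y - z) + t)" and ?m3.0 = "chi l 3 * (r * cos (- x - y + z) + t)"])
      show "chi l 0 * (r * cos (x + y + z) + t) * v $ 0 = \<mu> * a $ 0"
        using eq[of 0] cs 1 by (simp add: klein_add_def algebra_simps)
      show "chi l 1 * (r * cos (x - y - z) + t) * v $ 1 = \<mu> * a $ 1"
        using eq[of 1] cs 1 by (simp add: klein_add_def algebra_simps)
      show "chi l 2 * (r * cos (- x + y - z) + t) * v $ 2 = \<mu> * a $ 2"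
        using eq[of 2] cs 1 by (simp add: klein_add_def algebra_simps)
      show "chi l 3 * (r * cos (- x - y + z) + t) * v $ 3 = \<mu> * a $ 3"
        using eq[of 3] cs 1 by (simp add: klein_add_def algebra_simps)
      define p0 p1 p2 p3 where p: "p0 = r * cos (x + y + z) + t" "p1 = r * cos (x - y - z) + t"
        "p2 = r * cos (- x + y - z) + t" "p3 = r * cos (- x - y + z) + t"
      have "(a $ 0)\<^sup>2 * (chi l 1 * p1 * (chi l 2 * p2) * (chi l 3 * p3)) + (a $ 1)\<^sup>2 * (chi l 0 * p0 * (chi l 2 * p2) * (chi l 3 * p3))
         + (a $ 2)\<^sup>2 * (chi l 0 * p0 * (chi l 1 * p1) * (chi l 3 * p3)) + (a $ 3)\<^sup>2 * (chi l 0 * p0 * (chi l 1 * p1) * (chi l 2 * p2))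
        = sin (x + y + z) * (p1 * p2 * p3) + sin (x - y - z) * (p0 * p2 * p3) + sin (- x + y - z) * (p0 * p1 * p3)
         + sin (- x - y + z) * (p0 * p1 * p2)"
        unfolding sn by (cases l rule: cases_4; simp add: chi_def)
      then show "(a $ 0)\<^sup>2 * (chi l 1 * (r * cos (x - y - z) + t) * (chi l 2 * (r * cos (- x + y - z) + t)) * (chi l 3 * (r * cos (- x - y + z) + t)))
         + (a $ 1)\<^sup>2 * (chi l 0 * (r * cos (x + y + z) + t) * (chi l 2 * (r * cos (- x + y - z) + t)) * (chi l 3 * (r * cos (- x - y + z) + t)))
         + (a $ 2)\<^sup>2 * (chi l 0 * (r * cos (x + y + z) + t) * (chi l 1 * (r * cos (x - y - z) + t)) * (chi l 3 * (r * cos (- x - y + z) + t)))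
         + (a $ 3)\<^sup>2 * (chi l 0 * (r * cos (x + y + z) + t) * (chi l 1 * (r * cos (x - y - z) + t)) * (chi l 2 * (r * cos (- x + y - z) + t))) \<noteq> 0"
        unfolding p using nz by simp
    qed (fact plane)
  next
    case 2
    define e where "e = chi l 2"
    have ch: "chi l 0 = 1" "chi l 1 = 1" "chi l 2 = e" "chi l 3 = e" using 2 by (auto simp: chi_def e_def)
    have "e\<^sup>2 = 1" by (simp add: e_def)
    from paired_det_nonzero(1)[OF ad A r t this] show ?thesis
      by (rule paired_nondegenerate[where \<mu> = \<mu>])
        (use disc 2 eq[of 0] eq[of 1] eq[of 2] eq[of 3] plane ch in \<open>simp_all add: conic_disc_def klein_add_def algebra_simps\<close>)
  next
    case 3
    define e where "e = chi l 1"
    have ch: "chi l 0 = 1" "chi l 2 = 1" "chi l 1 = e" "chi l 3 = e" using 3 by (auto simp: chi_def e_def)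
    have "e\<^sup>2 = 1" by (simp add: e_def)
    from paired_det_nonzero(1)[OF angle_data_permute(1)[OF ad] A r t this]
    have "v $ 0 = 0 \<and> v $ 2 = 0 \<and> v $ 1 = 0 \<and> v $ 3 = 0"
      by (rule paired_nondegenerate[where \<mu> = \<mu>])
        (use disc 3 eq[of 0] eq[of 1] eq[of 2] eq[of 3] plane ch in \<open>simp_all add: conic_disc_def klein_add_def algebra_simps\<close>)
    then show ?thesis by blast
  next
    case 4
    define e where "e = chi l 1"
    have ch: "chi l 0 = 1" "chi l 3 = 1" "chi l 1 = e" "chi l 2 = e" using 4 by (auto simp: chi_def e_def)
    have "e\<^sup>2 = 1" by (simp add: e_def)
    from paired_det_nonzero(1)[OF angle_data_permute(2)[OF ad] A r t this]
    have "v $ 0 = 0 \<and> v $ 3 = 0 \<and> v $ 1 = 0 \<and> v $ 2 = 0"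
      by (rule paired_nondegenerate[where \<mu> = \<mu>])
        (use disc 4 eq[of 0] eq[of 1] eq[of 2] eq[of 3] plane ch in \<open>simp_all add: conic_disc_def klein_add_def algebra_simps\<close>)
    then show ?thesis by blast
  qed
  then show "v = 0" by (simp add: vec_eq_4)
qed

section \<open>Telling the conics apart\<close>

lemma mult_axis_pair: "(N *v (axis i p - axis j q)) $ m = N $ m $ i * p - N $ m $ j * q"
  for p q :: complex
proof -
  have "(N *v axis i p) $ m = N $ m $ i * p" for i p
    unfolding matrix_vector_mult_def
    by (simp add: axis_def if_distrib[of "\<lambda>x. _ * x"] cong: if_cong)
  then show ?thesis by (simp add: matrix_vector_mult_diff_distrib)
qed

lemma quad_axis_pair:
  "quad N (axis i p - axis j q) = N $ i $ i * p\<^sup>2 - (N $ i $ j + N $ j $ i) * (p * q) + N $ j $ j * q\<^sup>2"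
  unfolding quad_def dot_simps dot_commute[of "axis _ _"] dot_axis mult_axis_pair
  by (simp add: algebra_simps power2_eq_square)

definition independent_modulo :: "complex ^ 4 \<Rightarrow> complex ^ 4 \<Rightarrow> complex ^ 4 \<Rightarrow> bool" where
  "independent_modulo a u v \<longleftrightarrow> (\<forall>p q \<mu>. p *s u + q *s v = \<mu> *s a \<longrightarrow> p = 0 \<and> q = 0)"

definition polar_diag :: "complex ^ 4 \<Rightarrow> complex ^ 4 \<Rightarrow> complex ^ 4" where
  "polar_diag c v = (\<chi> i. c $ i * v $ i)"

text \<open>The vector \<open>w\<close> is the point of the plane on the edge \<open>i j\<close> of the coordinate tetrahedron. Both polars are supported on
  \<open>i\<close> and \<open>j\<close>, while \<open>a\<close> is not, so only a 2 by 2 determinant matters.\<close>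

lemma test_vector_edge:
  assumes "i \<noteq> j" "m \<noteq> i" "m \<noteq> j" "a $ m \<noteq> 0" and N: "N $ m $ i = 0" "N $ m $ j = 0"
    and det: "c $ i * a $ j * (N $ j $ i * a $ j - N $ j $ j * a $ i) + c $ j * a $ i * (N $ i $ i * a $ j - N $ i $ j * a $ i) \<noteq> 0"
  defines "w \<equiv> axis i (a $ j) - axis j (a $ i)"
  shows "dot a w = 0" "independent_modulo a (polar_diag c w) (N *v w)"
proof -
  show "dot a w = 0" by (simp add: w_def)
  show "independent_modulo a (polar_diag c w) (N *v w)"
    unfolding independent_modulo_def
  proof (intro allI impI)
    fix p q \<mu>
    assume *: "p *s polar_diag c w + q *s (N *v w) = \<mu> *s a"
    have comp: "p * (c $ n * w $ n) + q * (N $ n $ i * a $ j - N $ n $ j * a $ i) = \<mu> * a $ n" for n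
      using arg_cong[OF *, of "\<lambda>v. v $ n"] by (simp add: w_def mult_axis_pair polar_diag_def)
    have wc: "w $ i = a $ j" "w $ j = - a $ i" "w $ m = 0"
      using assms(1-3) by (auto simp: w_def axis_def)
    have "\<mu> = 0" using comp[of m] wc N \<open>a $ m \<noteq> 0\<close> by simp
    then have e: "p * (c $ i * a $ j) + q * (N $ i $ i * a $ j - N $ i $ j * a $ i) = 0"
      "- (p * (c $ j * a $ i)) + q * (N $ j $ i * a $ j - N $ j $ j * a $ i) = 0"
      using comp[of i] comp[of j] wc by simp_all
    define D where "D = c $ i * a $ j * (N $ j $ i * a $ j - N $ j $ j * a $ i) + c $ j * a $ i * (N $ i $ i * a $ j - N $ i $ j * a $ i)"
    have "D * p = 0" "D * q = 0" unfolding D_def using e by algebra+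
    with det D_def show "p = 0 \<and> q = 0" by simp
  qed
qed

text \<open>At least one of the points on two opposite edges is off the conic: in the sum of the two values of \<open>r \<phi> + t Q\<close> the
  contribution of \<open>\<phi>\<close> cancels by \<open>sines\<close>.\<close>

lemma test_vector_partition:
  assumes dist: "i \<noteq> j" "m \<noteq> n" "m \<noteq> i" "m \<noteq> j" "n \<noteq> i" "n \<noteq> j" and a: "a $ m \<noteq> 0" "a $ i \<noteq> 0"
    and N: "fundamental_matrix k l $ m $ i = 0" "fundamental_matrix k l $ m $ j = 0" "fundamental_matrix k l $ i $ m = 0" "fundamental_matrix k l $ i $ n = 0"
    and det1: "c $ i * a $ j * (fundamental_matrix k l $ j $ i * a $ j - fundamental_matrix k l $ j $ j * a $ i)
       + c $ j * a $ i * (fundamental_matrix k l $ i $ i * a $ j - fundamental_matrix k l $ i $ j * a $ i) \<noteq> 0"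
    and det2: "c $ m * a $ n * (fundamental_matrix k l $ n $ m * a $ n - fundamental_matrix k l $ n $ n * a $ m)
       + c $ n * a $ m * (fundamental_matrix k l $ m $ m * a $ n - fundamental_matrix k l $ m $ n * a $ m) \<noteq> 0"
    and sines: "(a $ i)\<^sup>2 * c $ j + (a $ j)\<^sup>2 * c $ i + ((a $ m)\<^sup>2 * c $ n + (a $ n)\<^sup>2 * c $ m) = 0"
    and t: "t \<noteq> 0" and disc: "quad (fundamental_matrix k l) (axis i (a $ j) - axis j (a $ i)) + quad (fundamental_matrix k l) (axis m (a $ n) - axis n (a $ m)) \<noteq> 0"
  shows "\<exists>w. dot a w = 0 \<and> quad (conic_matrix c r t k l) w \<noteq> 0 \<and> independent_modulo a (polar_diag c w) (fundamental_matrix k l *v w)"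
proof -
  have diag: "(\<Sum>h\<in>UNIV. c $ h * ((axis i p - axis j q) $ h)\<^sup>2) = c $ i * p\<^sup>2 + c $ j * q\<^sup>2" if "i \<noteq> j" for i j :: 4 and p q
  proof -
    have "(\<Sum>h\<in>UNIV. c $ h * ((axis i p - axis j q) $ h)\<^sup>2)
      = (\<Sum>h\<in>UNIV. (if h = i then c $ i * p\<^sup>2 else 0) + (if h = j then c $ j * q\<^sup>2 else 0))"
      by (rule sum.cong) (use that in \<open>auto simp: axis_def\<close>)
    then show ?thesis by (simp add: sum.distrib)
  qed
  have "quad (conic_matrix c r t k l) (axis i (a $ j) - axis j (a $ i)) + quad (conic_matrix c r t k l) (axis m (a $ n) - axis n (a $ m))
    = r * ((a $ i)\<^sup>2 * c $ j + (a $ j)\<^sup>2 * c $ i + ((a $ m)\<^sup>2 * c $ n + (a $ n)\<^sup>2 * c $ m))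
    + t * (quad (fundamental_matrix k l) (axis i (a $ j) - axis j (a $ i)) + quad (fundamental_matrix k l) (axis m (a $ n) - axis n (a $ m)))"
    unfolding quad_conic_matrix diag[OF dist(1)] diag[OF dist(2)] by (simp add: algebra_simps)
  also have "\<dots> \<noteq> 0" using sines t disc by simp
  finally consider "quad (conic_matrix c r t k l) (axis i (a $ j) - axis j (a $ i)) \<noteq> 0"
    | "quad (conic_matrix c r t k l) (axis m (a $ n) - axis n (a $ m)) \<noteq> 0" by force
  then show ?thesis
  proof cases
    case 1
    then show ?thesis using test_vector_edge[OF dist(1,3,4) a(1) N(1,2) det1] by blast
  next
    case 2
    then show ?thesis using test_vector_edge[OF dist(2) dist(3)[symmetric] dist(5)[symmetric] a(2) N(3,4) det2] by blast
  qed
qed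

lemma test_vector_paired:
  assumes dist: "i \<noteq> j" "m \<noteq> n" "m \<noteq> i" "m \<noteq> j" "n \<noteq> i" "n \<noteq> j" and klein_add: "klein_add k i = j" "klein_add k m = n"
    and chi: "chi l i = 1" "chi l j = 1" "chi l m = e" "chi l n = e" "e \<noteq> 0"
    and a: "a $ m \<noteq> 0" "a $ i \<noteq> 0"
    and ind: "(a $ i)\<^sup>2 * c $ j \<noteq> (a $ j)\<^sup>2 * c $ i" "(a $ m)\<^sup>2 * c $ n \<noteq> (a $ n)\<^sup>2 * c $ m"
    and sines: "(a $ i)\<^sup>2 * c $ j + (a $ j)\<^sup>2 * c $ i + ((a $ m)\<^sup>2 * c $ n + (a $ n)\<^sup>2 * c $ m) = 0"
    and t: "t \<noteq> 0" and sum: "a $ i * a $ j + e * (a $ m * a $ n) \<noteq> 0"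
  shows "\<exists>w. dot a w = 0 \<and> quad (conic_matrix c r t k l) w \<noteq> 0 \<and> independent_modulo a (polar_diag c w) (fundamental_matrix k l *v w)"
proof -
  have klein': "klein_add k j = i" "klein_add k n = m" using klein_add klein_add_involutive by metis+
  have N: "fundamental_matrix k l $ p $ q = (if q = klein_add k p then chi l p else 0)" for p q
    by (simp add: fundamental_matrix_def)
  show ?thesis
  proof (rule test_vector_partition[OF dist a _ _ _ _ _ _ sines t])
    show "quad (fundamental_matrix k l) (axis i (a $ j) - axis j (a $ i)) + quad (fundamental_matrix k l) (axis m (a $ n) - axis n (a $ m)) \<noteq> 0"
    proof -
      have "quad (fundamental_matrix k l) (axis i (a $ j) - axis j (a $ i)) + quad (fundamental_matrix k l) (axis m (a $ n) - axis n (a $ m))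
          = - 2 * (a $ i * a $ j + e * (a $ m * a $ n))"
        unfolding quad_axis_pair using dist klein_add klein' chi by (simp add: N algebra_simps)
      also have "\<dots> \<noteq> 0" by (rule no_zero_divisors[OF _ sum]) simp
      finally show ?thesis .
    qed
  qed (use dist klein_add klein' chi ind in \<open>auto simp: N algebra_simps power2_eq_square\<close>)
qed

text \<open>On two opposite edges from the partition belonging to \<open>k\<close> the values of \<open>Q\<close> add up, up to sign, to the discriminant
  of \<open>Q\<close> in the trope, which does not vanish.\<close>

lemma ex_test_vector:
  assumes kt: "kummer_trope w a c" and kl: "(k, l) \<in> even_pairs" and A: "cA w \<noteq> 0" and E: "cE w \<noteq> 0"
    and sq: "(cB w)\<^sup>2 \<noteq> (cA w)\<^sup>2" "(cC w)\<^sup>2 \<noteq> (cA w)\<^sup>2" "(cD w)\<^sup>2 \<noteq> (cA w)\<^sup>2"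
    and sq': "(cB w)\<^sup>2 \<noteq> (cC w)\<^sup>2" "(cB w)\<^sup>2 \<noteq> (cD w)\<^sup>2" "(cC w)\<^sup>2 \<noteq> (cD w)\<^sup>2"
    and disc: "conic_disc k l w S \<noteq> 0" and r: "r\<^sup>2 = cA w" and t: "t\<^sup>2 = - S" "t \<noteq> 0"
  shows "\<exists>v. dot a v = 0 \<and> quad (conic_matrix c r t k l) v \<noteq> 0 \<and> independent_modulo a (polar_diag c v) (fundamental_matrix k l *v v)"
proof -
  have ad: "angle_data (cA w) (cB w) (cC w) (cD w) (cE w) (a $ 0) (a $ 1) (a $ 2) (a $ 3) (c $ 0) (c $ 1) (c $ 2) (c $ 3)"
    using kt unfolding kummer_trope_def .
  note ad2 = angle_data_permute(1)[OF ad] and ad3 = angle_data_permute(2)[OF ad]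
  have a: "a $ 0 \<noteq> 0" "a $ 1 \<noteq> 0" "a $ 2 \<noteq> 0" "a $ 3 \<noteq> 0"
    using angle_data_relations(7)[OF ad] E by auto
  have sines: "a0\<^sup>2 * c1 + a1\<^sup>2 * c0 + (a2\<^sup>2 * c3 + a3\<^sup>2 * c2) = 0"
    if "angle_data A b c d E a0 a1 a2 a3 c0 c1 c2 c3" for A b c d E a0 a1 a2 a3 c0 c1 c2 c3
    by (rule angle_data_sines[OF that]) simp
  have quad2: "quad (fundamental_matrix k l) (axis i p - axis j q) = fundamental_matrix k l $ i $ i * p\<^sup>2 - (fundamental_matrix k l $ i $ j + fundamental_matrix k l $ j $ i) * (p * q)
      + fundamental_matrix k l $ j $ j * q\<^sup>2" for i j p q by (rule quad_axis_pair)
  consider "k = 0" | "k = 1" "l = 0 \<or> l = 1" | "k = 2" "l = 0 \<or> l = 2" | "k = 3" "l = 0 \<or> l = 3"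
    using kl unfolding even_pairs_eq by auto
  then show ?thesis
  proof cases
    case 1
    obtain x y z where xyz: "cA w * cos (2 * x) = chi l 1 * cB w" "cA w * cos (2 * y) = chi l 2 * cC w"
      "cA w * cos (2 * z) = chi l 3 * cD w"
      and sn: "(a $ 0)\<^sup>2 = sin (x + y + z)" "(a $ 1)\<^sup>2 = chi l 1 * sin (x - y - z)"
        "(a $ 2)\<^sup>2 = chi l 2 * sin (- x + y - z)" "(a $ 3)\<^sup>2 = chi l 3 * sin (- x - y + z)"
      using angle_data_shift[OF ad, of l] by metis
    have ne: "chi l i * p \<noteq> cA w" if "p\<^sup>2 \<noteq> (cA w)\<^sup>2" for i p
    proof
      assume "chi l i * p = cA w"
      then have "(cA w)\<^sup>2 = (chi l i * p)\<^sup>2" by simp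
      then show False using that by (simp add: power_mult_distrib)
    qed
    have "sin (x + y + z) + sin (x - y - z) + sin (- x + y - z) + sin (- x - y + z) \<noteq> 0"
      unfolding bordered_diagonal_coeffs(1)
      using nonzero_if_cos_double[OF xyz(1) ne[OF sq(1)]] nonzero_if_cos_double[OF xyz(2) ne[OF sq(2)]]
        nonzero_if_cos_double[OF xyz(3) ne[OF sq(3)]] by simp
    also have "sin (x + y + z) + sin (x - y - z) + sin (- x + y - z) + sin (- x - y + z)
      = (a $ 0)\<^sup>2 + chi l 1 * (a $ 1)\<^sup>2 + chi l 2 * (a $ 2)\<^sup>2 + chi l 3 * (a $ 3)\<^sup>2"
      unfolding sn by (simp flip: mult.assoc)
    finally have sum: "(a $ 0)\<^sup>2 + chi l 1 * (a $ 1)\<^sup>2 + chi l 2 * (a $ 2)\<^sup>2 + chi l 3 * (a $ 3)\<^sup>2 \<noteq> 0" .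
    have c01: "c $ 1 * chi l 0 \<noteq> c $ 0 * chi l 1" and c23: "c $ 3 * chi l 2 \<noteq> c $ 2 * chi l 3"
    proof -
      have "(c $ 1)\<^sup>2 \<noteq> (c $ 0)\<^sup>2" "(c $ 3)\<^sup>2 \<noteq> (c $ 2)\<^sup>2"
        using angle_data_fourth_powers[OF ad A sq'(3) sq(1)] angle_data_relations(1-4)[OF ad]
        by (metis add_left_cancel)+
      then have "(c $ 1 * chi l 0)\<^sup>2 \<noteq> (c $ 0 * chi l 1)\<^sup>2" "(c $ 3 * chi l 2)\<^sup>2 \<noteq> (c $ 2 * chi l 3)\<^sup>2"
        by (simp_all add: power_mult_distrib)
      then show "c $ 1 * chi l 0 \<noteq> c $ 0 * chi l 1" "c $ 3 * chi l 2 \<noteq> c $ 2 * chi l 3" by auto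
    qed
    show ?thesis
    proof (rule test_vector_partition[where i = 0 and j = 1 and m = 2 and n = 3])
      show "(a $ 0)\<^sup>2 * c $ 1 + (a $ 1)\<^sup>2 * c $ 0 + ((a $ 2)\<^sup>2 * c $ 3 + (a $ 3)\<^sup>2 * c $ 2) = 0"
        by (rule sines[OF ad])
      show "quad (fundamental_matrix k l) (axis 0 (a $ 1) - axis 1 (a $ 0)) + quad (fundamental_matrix k l) (axis 2 (a $ 3) - axis 3 (a $ 2)) \<noteq> 0"
        using sum 1 unfolding quad2
        by (cases l rule: cases_4; simp add: fundamental_matrix_def klein_add_def chi_def) (auto simp: algebra_simps eq_neg_iff_add_eq_0)
      show "c $ 0 * a $ 1 * (fundamental_matrix k l $ 1 $ 0 * a $ 1 - fundamental_matrix k l $ 1 $ 1 * a $ 0)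
         + c $ 1 * a $ 0 * (fundamental_matrix k l $ 0 $ 0 * a $ 1 - fundamental_matrix k l $ 0 $ 1 * a $ 0) \<noteq> 0"
        using c01 a 1 by (simp add: fundamental_matrix_def klein_add_def algebra_simps)
      show "c $ 2 * a $ 3 * (fundamental_matrix k l $ 3 $ 2 * a $ 3 - fundamental_matrix k l $ 3 $ 3 * a $ 2)
         + c $ 3 * a $ 2 * (fundamental_matrix k l $ 2 $ 2 * a $ 3 - fundamental_matrix k l $ 2 $ 3 * a $ 2) \<noteq> 0"
        using c23 a 1 by (simp add: fundamental_matrix_def klein_add_def algebra_simps)
    qed (use a t 1 in \<open>simp_all add: fundamental_matrix_def klein_add_def\<close>)
  next
    case 2
    have "(chi l 2)\<^sup>2 = 1" by simp
    have "pair_disc (cA w) (cB w) (cC w) (cD w) (cE w) (chi l 2) S \<noteq> 0"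
      using disc 2 by (simp add: conic_disc_def)
    note sum = paired_det_nonzero(2)[OF ad A r t(1) \<open>(chi l 2)\<^sup>2 = 1\<close> this]
    note ind = angle_data_independent[OF ad A sq'(3)]
    show ?thesis
      by (rule test_vector_paired[where i = 0 and j = 1 and m = 2 and n = 3, OF _ _ _ _ _ _ _ _ _ _ _ _ _ _ _ ind sines[OF ad] t(2) sum])
        (use a 2 in \<open>auto simp: klein_add_def chi_def\<close>)
  next
    case 3
    have "(chi l 1)\<^sup>2 = 1" by simp
    have "pair_disc (cA w) (cC w) (cB w) (cD w) (cE w) (chi l 1) S \<noteq> 0"
      using disc 3 by (simp add: conic_disc_def)
    note sum = paired_det_nonzero(2)[OF ad2 A r t(1) \<open>(chi l 1)\<^sup>2 = 1\<close> this]
    note ind = angle_data_independent[OF ad2 A sq'(2)]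
    show ?thesis
      by (rule test_vector_paired[where i = 0 and j = 2 and m = 1 and n = 3, OF _ _ _ _ _ _ _ _ _ _ _ _ _ _ _ ind sines[OF ad2] t(2) sum])
        (use a 3 in \<open>auto simp: klein_add_def chi_def\<close>)
  next
    case 4
    have "(chi l 1)\<^sup>2 = 1" by simp
    have "pair_disc (cA w) (cD w) (cB w) (cC w) (cE w) (chi l 1) S \<noteq> 0"
      using disc 4 by (simp add: conic_disc_def)
    note sum = paired_det_nonzero(2)[OF ad3 A r t(1) \<open>(chi l 1)\<^sup>2 = 1\<close> this]
    note ind = angle_data_independent[OF ad3 A sq'(1)]
    show ?thesis
      by (rule test_vector_paired[where i = 0 and j = 3 and m = 1 and n = 2, OF _ _ _ _ _ _ _ _ _ _ _ _ _ _ _ ind sines[OF ad3] t(2) sum])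
        (use a 4 in \<open>auto simp: klein_add_def chi_def\<close>)
  qed
qed

text \<open>If the conics were equal, \<open>r \<phi> - t Q\<close> would have the polar \<open>\<kappa>\<close> times that of \<open>r \<phi> + t Q\<close> at \<open>v\<close>. Independence of the polars of
  \<open>\<phi>\<close> and \<open>Q\<close> then forces both \<open>\<kappa> = 1\<close> and \<open>\<kappa> = -1\<close>.\<close>

lemma conics_in_trope_distinct:
  fixes a :: "complex ^ 4"
  assumes "a \<noteq> 0" and kl: "(k, l) \<in> even_pairs" and nd: "nondegenerate_on a (conic_matrix c r t k l)"
    and "r \<noteq> 0" "t \<noteq> 0"
    and v: "dot a v = 0" "quad (conic_matrix c r t k l) v \<noteq> 0" "independent_modulo a (polar_diag c v) (fundamental_matrix k l *v v)"
  shows "plane_conic a (conic_matrix c r t k l) \<noteq> plane_conic a (conic_matrix c r (- t) k l)"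
proof
  assume eq: "plane_conic a (conic_matrix c r t k l) = plane_conic a (conic_matrix c r (- t) k l)"
  have mult: "conic_matrix c r s k l *v v = r *s polar_diag c v + s *s (fundamental_matrix k l *v v)" for s
    by (simp add: vec_eq_iff conic_matrix_mult polar_diag_def)
  obtain \<kappa> \<mu> where "conic_matrix c r (- t) k l *v v = \<kappa> *s (conic_matrix c r t k l *v v) + \<mu> *s a"
    using polars_of_equal_conics[OF \<open>a \<noteq> 0\<close> transpose_conic_matrix[OF kl] transpose_conic_matrix[OF kl] nd eq v(1,2)] by blast
  then have "(r * (1 - \<kappa>)) *s polar_diag c v + (- t * (1 + \<kappa>)) *s (fundamental_matrix k l *v v) = \<mu> *s a"
    unfolding mult by (simp add: vec_eq_iff algebra_simps)
  then have "r * (1 - \<kappa>) = 0" "- t * (1 + \<kappa>) = 0"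
    using v(3) unfolding independent_modulo_def by blast+
  then have "1 - \<kappa> = 0" "1 + \<kappa> = 0" using \<open>r \<noteq> 0\<close> \<open>t \<noteq> 0\<close> by simp_all
  then show False by (simp add: eq_neg_iff_add_eq_0 add.commute)
qed

text \<open>Comparing squares at the indices \<open>k\<close> and \<open>k'\<close>, where the two translations give \<open>0\<close> and \<open>m = k + k'\<close> in opposite order, yields
  \<open>(a $ 0)\<^sup>4 = (a $ m)\<^sup>4\<close>. So the translations agree, and then the characters.\<close>

lemma heisenberg_orbit_free:
  assumes a4: "\<And>m. m \<noteq> 0 \<Longrightarrow> (a $ m)^4 \<noteq> (a $ 0)^4"
    and eq: "heisenberg_action k l a = t *s heisenberg_action k' l' a" and nz: "\<And>i. a $ i \<noteq> 0"
  shows "k = k' \<and> l = l'"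
proof -
  have comp: "chi l i * a $ klein_add k i = t * (chi l' i * a $ klein_add k' i)" for i
    using arg_cong[OF eq, of "\<lambda>v. v $ i"] by (simp add: heisenberg_action_def)
  have sq: "(a $ klein_add k i)\<^sup>2 = t\<^sup>2 * (a $ klein_add k' i)\<^sup>2" for i
    using arg_cong[OF comp[of i], of "\<lambda>x. x\<^sup>2"] by (simp add: power_mult_distrib)
  have "k = k'"
  proof (rule ccontr)
    assume "k \<noteq> k'"
    define m where "m = klein_add k k'"
    have m: "klein_add k' k = m" "m \<noteq> 0"
      using \<open>k \<noteq> k'\<close> unfolding m_def
      by (cases k rule: cases_4; cases k' rule: cases_4; simp add: klein_add_def)+
    have s: "(a $ 0)\<^sup>2 = t\<^sup>2 * (a $ m)\<^sup>2" "(a $ m)\<^sup>2 = t\<^sup>2 * (a $ 0)\<^sup>2"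
      using sq[of k] sq[of k'] m(1) by (simp_all add: m_def)
    have "(a $ 0)\<^sup>2 * (a $ 0)\<^sup>2 = (a $ m)\<^sup>2 * (a $ m)\<^sup>2"
      using s by algebra
    then have "(a $ m)^4 = (a $ 0)^4" by (simp add: power4_eq_xxxx power2_eq_square mult.assoc)
    then show False using a4 m(2) by blast
  qed
  moreover have "chi l i = chi l' i" for i
  proof -
    have "chi l i = t * chi l' i" for i using comp[of i] nz \<open>k = k'\<close> by simp
    from this[of 0] this[of i] show ?thesis by simp
  qed
  then have "l = l'" by (rule chi_eqD)
  ultimately show ?thesis by blast
qed

text \<open>The value of \<open>(g1 + 2 g2) / 2\<close> at the trope \<open>a\<close>, times \<open>A\<^sup>2\<close>. Divided by the value of \<open>g4\<close> it only depends on the plane, and it is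
  rational in the coefficients of the Kummer surface. The ratio of \<open>g1\<close> to \<open>g4\<close> alone does not distinguish the Kummer surfaces
  that belong to the pairs \<open>(0,0)\<close> and \<open>(0,1)\<close>.\<close>

definition trope_invariant :: "coeffs \<Rightarrow> complex" where
  "trope_invariant w = cC w * cD w - cA w * cB w + 2 * (cB w * cD w - cA w * cC w)"

lemma tropes_of_distinct_kummers:
  assumes kt: "kummer_trope w a c" "kummer_trope w' a' c'" and A: "cA w \<noteq> 0" "cA w' \<noteq> 0"
    and sep: "trope_invariant w * (cA w' * cE w') \<noteq> trope_invariant w' * (cA w * cE w)"
  shows "a \<noteq> t *s a'"
proof
  assume t: "a = t *s a'"
  define J where "J a = (a $ 0)\<^sup>2 * (a $ 1)\<^sup>2 + (a $ 2)\<^sup>2 * (a $ 3)\<^sup>2 + 2 * ((a $ 0)\<^sup>2 * (a $ 2)\<^sup>2 + (a $ 1)\<^sup>2 * (a $ 3)\<^sup>2)"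
    for a :: "complex ^ 4"
  define P where "P a = a $ 0 * a $ 1 * a $ 2 * a $ 3" for a :: "complex ^ 4"
  have inv: "(cA w)\<^sup>2 * J a = trope_invariant w" "2 * cA w * P a = cE w" if "kummer_trope w a c" for w a c
  proof -
    note ad = that[unfolded kummer_trope_def]
    show "2 * cA w * P a = cE w" using angle_data_relations(7)[OF ad] by (simp add: P_def)
    show "(cA w)\<^sup>2 * J a = trope_invariant w"
      using angle_data_relations(8)[OF ad] angle_data_relations(8)[OF angle_data_permute(1)[OF ad]]
      unfolding J_def trope_invariant_def by algebra
  qed
  have "J a * P a' = J a' * P a"
    unfolding t J_def P_def by (simp add: algebra_simps power2_eq_square)
  then have "trope_invariant w * (cA w' * cE w') = trope_invariant w' * (cA w * cE w)"
    using inv[OF kt(1)] inv[OF kt(2)] by algebra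
  with sep show False by blast
qed

section \<open>The 320 conics\<close>

definition genericity :: "4 \<Rightarrow> 4 \<Rightarrow> coeffs \<Rightarrow> complex" where
  "genericity k l w = (let w' = residual (node k l) w in
     segre w * segre_deriv (node k l) w * cA w' * cE w'
     * ((cB w')\<^sup>2 - (cA w')\<^sup>2) * ((cC w')\<^sup>2 - (cA w')\<^sup>2) * ((cD w')\<^sup>2 - (cA w')\<^sup>2)
     * ((cB w')\<^sup>2 - (cC w')\<^sup>2) * ((cB w')\<^sup>2 - (cD w')\<^sup>2) * ((cC w')\<^sup>2 - (cD w')\<^sup>2)
     * conic_disc k l w' (segre w))"

definition separation :: "4 \<times> 4 \<Rightarrow> 4 \<times> 4 \<Rightarrow> coeffs \<Rightarrow> complex" where
  "separation q q' w =
     (let v = residual (node (fst q) (snd q)) w; v' = residual (node (fst q') (snd q')) w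
      in trope_invariant v * (cA v' * cE v') - trope_invariant v' * (cA v * cE v))"

definition generic_coeffs :: "coeffs \<Rightarrow> complex" where
  "generic_coeffs w = (\<Prod>q\<in>even_pairs. genericity (fst q) (snd q) w)
     * (\<Prod>q\<in>even_pairs. \<Prod>q'\<in>even_pairs - {q}. separation q q' w)"

lemma finite_even_pairs: "finite even_pairs"
  by (simp add: even_pairs_eq)

lemma generic_coeffs_nonzero_iff:
  "generic_coeffs w \<noteq> 0 \<longleftrightarrow> (\<forall>q\<in>even_pairs. genericity (fst q) (snd q) w \<noteq> 0 \<and>
     (\<forall>q'\<in>even_pairs. q \<noteq> q' \<longrightarrow> separation q q' w \<noteq> 0))"
  unfolding generic_coeffs_def mult_eq_0_iff de_Morgan_disj prod_zero_iff[OF finite_even_pairs]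
    prod_zero_iff[OF finite_Diff[OF finite_even_pairs]]
  by (simp only: Bex_def Ball_def Diff_iff singleton_iff) metis

lemma plane_conics_same_plane:
  fixes a b :: "complex ^ 4"
  assumes "plane_conic a M = plane_conic b N" "a \<noteq> 0" "transpose M = M" "nondegenerate_on a M"
  shows "\<exists>t. b = t *s a"
  using conic_spans_plane[OF assms(2-4)] plane_conic_eqD[OF assms(1)] by blast

text \<open>The conics are indexed by a fundamental quadric \<open>(k, l)\<close>, an element \<open>(g, h)\<close> of the Heisenberg group modulo its centre, which
  selects one of the 16 tropes, and the sign of \<open>t\<close>.\<close>

lemma generic_quartic_contains_320_conics:
  assumes gen: "generic_coeffs w \<noteq> 0"
  shows "\<exists>\<C>. card \<C> = 320 \<and> (\<forall>C\<in>\<C>. smooth_conic C \<and> (\<exists>a M. C = plane_conic a M \<and>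
     (\<forall>v. dot a v = 0 \<longrightarrow> quad M v = 0 \<longrightarrow> quartic w v = 0)))"
proof -
  define res where "res k l = residual (node k l) w" for k l
  have g: "segre w \<noteq> 0" "segre_deriv (node k l) w \<noteq> 0" "cA (res k l) \<noteq> 0" "cE (res k l) \<noteq> 0"
    "(cB (res k l))\<^sup>2 \<noteq> (cA (res k l))\<^sup>2" "(cC (res k l))\<^sup>2 \<noteq> (cA (res k l))\<^sup>2" "(cD (res k l))\<^sup>2 \<noteq> (cA (res k l))\<^sup>2"
    "(cB (res k l))\<^sup>2 \<noteq> (cC (res k l))\<^sup>2" "(cB (res k l))\<^sup>2 \<noteq> (cD (res k l))\<^sup>2" "(cC (res k l))\<^sup>2 \<noteq> (cD (res k l))\<^sup>2"
    "conic_disc k l (res k l) (segre w) \<noteq> 0" if "(k, l) \<in> even_pairs" for k l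
  proof -
    have "genericity k l w \<noteq> 0" using gen that unfolding generic_coeffs_nonzero_iff by fastforce
    then show "segre w \<noteq> 0" "segre_deriv (node k l) w \<noteq> 0" "cA (res k l) \<noteq> 0" "cE (res k l) \<noteq> 0"
    "(cB (res k l))\<^sup>2 \<noteq> (cA (res k l))\<^sup>2" "(cC (res k l))\<^sup>2 \<noteq> (cA (res k l))\<^sup>2" "(cD (res k l))\<^sup>2 \<noteq> (cA (res k l))\<^sup>2"
    "(cB (res k l))\<^sup>2 \<noteq> (cC (res k l))\<^sup>2" "(cB (res k l))\<^sup>2 \<noteq> (cD (res k l))\<^sup>2" "(cC (res k l))\<^sup>2 \<noteq> (cD (res k l))\<^sup>2"
    "conic_disc k l (res k l) (segre w) \<noteq> 0"
      unfolding genericity_def Let_def res_def[symmetric] by auto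
  qed
  have "\<exists>a c. (k, l) \<in> even_pairs \<longrightarrow> kummer_trope (res k l) a c" for k l
    using ex_kummer_trope[of "res k l"] segre_residual[of k l w] g(3)[of k l] unfolding res_def by blast
  then obtain a c where kt0: "\<And>k l. (k, l) \<in> even_pairs \<Longrightarrow> kummer_trope (res k l) (a k l) (c k l)" by metis
  define r where "r k l = csqrt (cA (res k l))" for k l
  define t where "t b = (if b then csqrt (- segre w) else - csqrt (- segre w))" for b
  define plane where "plane k l g h = heisenberg_action g h (a k l)" for k l g h
  define M where "M k l g b = conic_matrix (heisenberg_action g 0 (c k l)) (r k l) (t b) k l" for k l g b
  define conic where "conic = (\<lambda>((k, l), (g, h), b). plane_conic (plane k l g h) (M k l g b))"
  have r: "(r k l)\<^sup>2 = cA (res k l)" and t: "(t b)\<^sup>2 = - segre w" for k l b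
    by (simp_all add: r_def t_def)
  have kt: "kummer_trope (res k l) (plane k l g h) (heisenberg_action g 0 (c k l))" if "(k, l) \<in> even_pairs" for k l g h
    unfolding plane_def by (rule kummer_trope_heisenberg[OF kt0[OF that]])
  have nz: "plane k l g h $ i \<noteq> 0" if "(k, l) \<in> even_pairs" for k l g h i
    using angle_data_relations(7)[OF kt[OF that, of g h, unfolded kummer_trope_def]] g(4)[OF that]
    by (cases i rule: cases_4) auto
  then have nz0: "plane k l g h \<noteq> 0" if "(k, l) \<in> even_pairs" for k l g h
    using that by (metis zero_index)
  have nd: "nondegenerate_on (plane k l g h) (M k l g b)" if kl: "(k, l) \<in> even_pairs" for k l g h b
    unfolding M_def by (rule conic_nondegenerate[OF kt[OF kl] kl g(3)[OF kl] g(5)[OF kl] g(6)[OF kl] g(7)[OF kl] g(11)[OF kl] r t])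
  have sym: "transpose (M k l g b) = M k l g b" if "(k, l) \<in> even_pairs" for k l g b
    unfolding M_def by (rule transpose_conic_matrix[OF that])
  have t_nz: "t b \<noteq> 0" for b
    using t[of b] g(1)[of 0 0] by (auto simp: even_pairs_eq)
  have r_nz: "r k l \<noteq> 0" if "(k, l) \<in> even_pairs" for k l
    using r[of k l] g(3)[OF that] by auto

  \<comment> \<open>In the trope \<open>\<delta> F = K + \<sigma> Q\<^sup>2\<close> becomes \<open>A' \<phi>\<^sup>2 + \<sigma> Q\<^sup>2\<close>, which is zero where \<open>r \<phi> = - t Q\<close>.\<close>
  have vanish: "quartic w v = 0" if kl: "(k, l) \<in> even_pairs" and v: "dot (plane k l g h) v = 0" "quad (M k l g b) v = 0" for k l g h b v
  proof -
    define \<phi> where "\<phi> = (\<Sum>i\<in>UNIV. heisenberg_action g 0 (c k l) $ i * (v $ i)\<^sup>2)"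
    define Q where "Q = quad (fundamental_matrix k l) v"
    have "r k l * \<phi> + t b * Q = 0" using v(2) unfolding M_def quad_conic_matrix \<phi>_def Q_def .
    then have "(r k l * \<phi>)\<^sup>2 = (t b * Q)\<^sup>2" by (simp add: eq_neg_iff_add_eq_0[symmetric])
    then have "cA (res k l) * \<phi>\<^sup>2 + segre w * Q\<^sup>2 = 0" by (simp add: power_mult_distrib r t)
    moreover have "quartic (res k l) v = cA (res k l) * \<phi>\<^sup>2"
      using quartic_kummer[OF kt[OF kl, of g h], of v] v(1) by (simp add: \<phi>_def)
    moreover have "quartic (node k l) v = Q\<^sup>2" unfolding Q_def by (rule quartic_node[OF kl])
    ultimately have "segre_deriv (node k l) w * quartic w v = 0"
      unfolding quartic_residual res_def[symmetric] by simp
    then show ?thesis using g(2)[OF kl] by simp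
  qed

  have inj: "inj_on conic (even_pairs \<times> UNIV \<times> UNIV)"
  proof (rule inj_onI, clarsimp)
    fix k l g h b k' l' g' h' b'
    assume kl: "(k, l) \<in> even_pairs" and kl': "(k', l') \<in> even_pairs"
      and "conic ((k, l), (g, h), b) = conic ((k', l'), (g', h'), b')"
    then have eq: "plane_conic (plane k l g h) (M k l g b) = plane_conic (plane k' l' g' h') (M k' l' g' b')"
      by (simp add: conic_def)
    obtain s where s: "plane k' l' g' h' = s *s plane k l g h"
      using plane_conics_same_plane[OF eq nz0[OF kl] sym[OF kl] nd[OF kl]] by blast
    \<comment> \<open>Equal planes are tropes of Kummer surfaces with the same invariants, so they come from the same quadric.\<close>
    have same: "(k, l) = (k', l')"
    proof (rule ccontr)
      assume "(k, l) \<noteq> (k', l')"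
      then have "separation (k', l') (k, l) w \<noteq> 0"
        using bspec[OF conjunct2[OF bspec[OF gen[unfolded generic_coeffs_nonzero_iff] kl']] kl] by auto
      then have "trope_invariant (res k' l') * (cA (res k l) * cE (res k l)) \<noteq> trope_invariant (res k l) * (cA (res k' l') * cE (res k' l'))"
        by (simp add: separation_def res_def Let_def)
      then show False using tropes_of_distinct_kummers[OF kt[OF kl'] kt[OF kl] g(3)[OF kl'] g(3)[OF kl]] s by blast
    qed
    then have s': "heisenberg_action g' h' (a k l) = s *s heisenberg_action g h (a k l)" using s by (simp add: plane_def)
    have a: "a k l $ i \<noteq> 0" for i using nz[OF kl, of 0 0 i] by (simp add: plane_def heisenberg_action_def klein_add_def)
    have ad: "angle_data (cA (res k l)) (cB (res k l)) (cC (res k l)) (cD (res k l)) (cE (res k l))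
       (a k l $ 0) (a k l $ 1) (a k l $ 2) (a k l $ 3) (c k l $ 0) (c k l $ 1) (c k l $ 2) (c k l $ 3)"
      using kt0[OF kl] unfolding kummer_trope_def .
    have a4: "(a k l $ m)^4 \<noteq> (a k l $ 0)^4" if "m \<noteq> 0" for m
      using that angle_data_fourth_powers(1)[OF ad g(3)[OF kl] g(10)[OF kl] g(5)[OF kl]]
        angle_data_fourth_powers(1)[OF angle_data_permute(1)[OF ad] g(3)[OF kl] g(9)[OF kl] g(6)[OF kl]]
        angle_data_fourth_powers(1)[OF angle_data_permute(2)[OF ad] g(3)[OF kl] g(8)[OF kl] g(7)[OF kl]]
      by (cases m rule: cases_4) auto
    have gh: "g' = g \<and> h' = h" by (rule heisenberg_orbit_free[OF a4 s' a])
    have "b = b'"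
    proof (rule ccontr)
      assume "b \<noteq> b'"
      then have "t b' = - t b" by (auto simp: t_def)
      moreover obtain v where "dot (plane k l g h) v = 0" "quad (M k l g b) v \<noteq> 0"
        "independent_modulo (plane k l g h) (polar_diag (heisenberg_action g 0 (c k l)) v) (fundamental_matrix k l *v v)"
        using ex_test_vector[OF kt[OF kl] kl g(3)[OF kl] g(4)[OF kl] g(5)[OF kl] g(6)[OF kl] g(7)[OF kl] g(8)[OF kl]
            g(9)[OF kl] g(10)[OF kl] g(11)[OF kl] r t t_nz] unfolding M_def by blast
      ultimately show False
        using conics_in_trope_distinct[OF nz0[OF kl] kl nd[OF kl, unfolded M_def] r_nz[OF kl] t_nz] eq same gh
        unfolding M_def by auto
    qed
    with same gh show "k = k' \<and> l = l' \<and> g = g' \<and> h = h' \<and> b = b'" by simp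
  qed
  have "card (conic ` (even_pairs \<times> UNIV \<times> UNIV)) = card (even_pairs \<times> (UNIV :: (4 \<times> 4) set) \<times> (UNIV :: bool set))"
    by (rule card_image[OF inj])
  also have "\<dots> = 320"
    by (simp only: card_cartesian_product card_even_pairs card_UNIV_bool card_prod) simp
  finally have "card (conic ` (even_pairs \<times> UNIV \<times> UNIV)) = 320" .
  moreover have "smooth_conic C \<and> (\<exists>a M. C = plane_conic a M \<and> (\<forall>v. dot a v = 0 \<longrightarrow> quad M v = 0 \<longrightarrow> quartic w v = 0))"
    if C: "C \<in> conic ` (even_pairs \<times> UNIV \<times> UNIV)" for C
  proof -
    obtain k l g h b where kl: "(k, l) \<in> even_pairs" and C: "C = plane_conic (plane k l g h) (M k l g b)"
      using C by (auto simp: conic_def)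
    have "smooth_conic C" unfolding C by (rule smooth_plane_conic[OF nz0[OF kl] sym[OF kl] nd[OF kl]])
    with vanish[OF kl] C show ?thesis by blast
  qed
  ultimately show ?thesis by blast
qed

section \<open>Genericity is a Zariski open condition\<close>

definition coeffs_of :: "complex ^ 6 \<Rightarrow> coeffs" where
  "coeffs_of u = Coeffs (- u $ 4 - u $ 5) (- u $ 0 - u $ 1 + u $ 2 + u $ 3) (- u $ 0 + u $ 1 - u $ 2 + u $ 3)
     (- u $ 0 + u $ 1 + u $ 2 - u $ 3) (2 * u $ 4 - 2 * u $ 5)"

lemma heisenberg_form_eq: "heisenberg_form u v = quartic (coeffs_of u) v"
  by (simp add: heisenberg_form_def quartic_def coeffs_of_def Let_def)

lemma form_scale_right: "form d f \<Longrightarrow> form d (\<lambda>v. f v * k)"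
  using form_scale[of d f k] by (simp add: mult.commute)

lemmas form_closure = form_scale form_scale_right form_mult form_power form_add form_diff form_uminus

lemma form_coeffs_of:
  "form 1 (\<lambda>u. cA (coeffs_of u))" "form 1 (\<lambda>u. cB (coeffs_of u))" "form 1 (\<lambda>u. cC (coeffs_of u))"
  "form 1 (\<lambda>u. cD (coeffs_of u))" "form 1 (\<lambda>u. cE (coeffs_of u))"
  unfolding coeffs_of_def coeffs.sel
  by (intro form_add form_diff form_uminus form_scale form_coordinate)+

lemma form_segre: "form 3 (\<lambda>u. segre (coeffs_of u))"
  unfolding segre_def by (rule form_coeffs_of form_closure refl | simp)+

lemma form_segre_deriv: "form 2 (\<lambda>u. segre_deriv n (coeffs_of u))"
  unfolding segre_deriv_def by (rule form_coeffs_of form_closure refl | simp)+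

lemma form_residual:
  "form 3 (\<lambda>u. cA (residual n (coeffs_of u)))" "form 3 (\<lambda>u. cB (residual n (coeffs_of u)))"
  "form 3 (\<lambda>u. cC (residual n (coeffs_of u)))" "form 3 (\<lambda>u. cD (residual n (coeffs_of u)))"
  "form 3 (\<lambda>u. cE (residual n (coeffs_of u)))"
  unfolding residual_def coeffs.sel
  by (rule form_segre form_segre_deriv form_coeffs_of form_closure refl | simp)+

lemma form_conic_disc: "\<exists>d. form d (\<lambda>u. conic_disc k l (residual n (coeffs_of u)) (segre (coeffs_of u)))"
proof -
  have "\<exists>d. form d (\<lambda>u. diag_disc (cA (residual n (coeffs_of u))) (p * cB (residual n (coeffs_of u))) (q * cC (residual n (coeffs_of u)))
      (s * cD (residual n (coeffs_of u))) (segre (coeffs_of u)))" for p q s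
    unfolding diag_disc_def by (rule exI, (rule form_residual form_segre form_closure refl | simp)+)
  moreover have "\<exists>d. form d (\<lambda>u. pair_disc (f u) (g u) (h u) (i u) (j u) e (segre (coeffs_of u)))"
    if "form 3 f" "form 3 g" "form 3 h" "form 3 i" "form 3 j" for f g h i j e
    unfolding pair_disc_def by (rule exI, (rule that form_segre form_closure refl | simp)+)
  ultimately have cases:
    "\<exists>d. form d (\<lambda>u. conic_disc k l (residual n (coeffs_of u)) (segre (coeffs_of u)))" if "k = 0 \<or> k = 1 \<or> k = 2 \<or> k = 3"
    using that form_residual[of n] unfolding conic_disc_def by (elim disjE) simp_all
  consider "k = 0" | "k = 1" | "k = 2" | "k = 3" by (cases k rule: cases_4)
  then show ?thesis
    using cases by cases simp_all
qed

lemma form_genericity: "\<exists>d. form d (\<lambda>u. genericity k l (coeffs_of u))"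
proof -
  obtain d where d: "form d (\<lambda>u. conic_disc k l (residual (node k l) (coeffs_of u)) (segre (coeffs_of u)))"
    using form_conic_disc by blast
  show ?thesis unfolding genericity_def Let_def
    by (rule exI, (rule d form_residual form_segre form_segre_deriv form_closure refl | simp)+)
qed

lemma form_separation: "\<exists>d. form d (\<lambda>u. separation q q' (coeffs_of u))"
  unfolding separation_def trope_invariant_def Let_def
  by (rule exI, (rule form_residual form_closure refl | simp)+)

lemma form_generic_coeffs: "\<exists>d. form d (\<lambda>u. generic_coeffs (coeffs_of u))"
proof -
  obtain d where d: "form d (\<lambda>u. \<Prod>q\<in>even_pairs. genericity (fst q) (snd q) (coeffs_of u))"
    using form_prod[OF finite_even_pairs, of "\<lambda>q u. genericity (fst q) (snd q) (coeffs_of u)"] form_genericity by blast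
  have "\<exists>e. form e (\<lambda>u. \<Prod>q'\<in>even_pairs - {q}. separation q q' (coeffs_of u))" for q
    using form_prod[OF finite_Diff[OF finite_even_pairs], of "{q}" "\<lambda>q' u. separation q q' (coeffs_of u)"] form_separation by blast
  then obtain e where e: "form e (\<lambda>u. \<Prod>q\<in>even_pairs. \<Prod>q'\<in>even_pairs - {q}. separation q q' (coeffs_of u))"
    using form_prod[OF finite_even_pairs, of "\<lambda>q u. \<Prod>q'\<in>even_pairs - {q}. separation q q' (coeffs_of u)"] by blast
  show ?thesis
    using form_mult[OF d e refl] unfolding generic_coeffs_def by blast
qed

text \<open>The point \<open>(-1, 3, 4, -2, -1)\<close> of the parameter space, scaled by 4 so that it comes from an integral vector \<open>u\<close>. Its ten
  residual points are listed to keep the numbers in the evaluation of the genericity conditions small.\<close>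

lemma example_residuals:
  "segre (Coeffs (- 4) 12 16 (- 8) (- 4)) = (- 1344)"
  "segre_deriv (node 0 0) (Coeffs (- 4) 12 16 (- 8) (- 4)) = (- 304)"
  "residual (node 0 0) (Coeffs (- 4) 12 16 (- 8) (- 4)) = Coeffs 2560 (- 2304) (- 3520) 3776 1216"
  "segre_deriv (node 0 1) (Coeffs (- 4) 12 16 (- 8) (- 4)) = (- 816)"
  "residual (node 0 1) (Coeffs (- 4) 12 16 (- 8) (- 4)) = Coeffs 4608 (- 8448) (- 14400) 5184 3264"
  "segre_deriv (node 0 2) (Coeffs (- 4) 12 16 (- 8) (- 4)) = (- 624)"
  "residual (node 0 2) (Coeffs (- 4) 12 16 (- 8) (- 4)) = Coeffs 3840 (- 8832) (- 8640) 3648 2496"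
  "segre_deriv (node 0 3) (Coeffs (- 4) 12 16 (- 8) (- 4)) = 144"
  "residual (node 0 3) (Coeffs (- 4) 12 16 (- 8) (- 4)) = Coeffs 768 384 960 192 (- 576)"
  "segre_deriv (node 1 0) (Coeffs (- 4) 12 16 (- 8) (- 4)) = (- 256)"
  "residual (node 1 0) (Coeffs (- 4) 12 16 (- 8) (- 4)) = Coeffs 1024 (- 384) (- 4096) 2048 3712"
  "segre_deriv (node 1 1) (Coeffs (- 4) 12 16 (- 8) (- 4)) = (- 384)"
  "residual (node 1 1) (Coeffs (- 4) 12 16 (- 8) (- 4)) = Coeffs 1536 (- 1920) (- 6144) 3072 (- 1152)"
  "segre_deriv (node 2 0) (Coeffs (- 4) 12 16 (- 8) (- 4)) = (- 64)"
  "residual (node 2 0) (Coeffs (- 4) 12 16 (- 8) (- 4)) = Coeffs 256 (- 768) 1664 512 2944"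
  "segre_deriv (node 2 2) (Coeffs (- 4) 12 16 (- 8) (- 4)) = (- 192)"
  "residual (node 2 2) (Coeffs (- 4) 12 16 (- 8) (- 4)) = Coeffs 768 (- 2304) (- 384) 1536 (- 1920)"
  "segre_deriv (node 3 0) (Coeffs (- 4) 12 16 (- 8) (- 4)) = 704"
  "residual (node 3 0) (Coeffs (- 4) 12 16 (- 8) (- 4)) = Coeffs (- 2816) 8448 11264 (- 2944) (- 128)"
  "segre_deriv (node 3 3) (Coeffs (- 4) 12 16 (- 8) (- 4)) = 576"
  "residual (node 3 3) (Coeffs (- 4) 12 16 (- 8) (- 4)) = Coeffs (- 2304) 6912 9216 (- 1920) (- 4992)"
  by (simp_all add: residual_def node_def chi_def segre_def segre_deriv_def)

lemma generic_coeffs_example: "generic_coeffs (Coeffs (- 4) 12 16 (- 8) (- 4)) \<noteq> 0"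
  unfolding generic_coeffs_nonzero_iff even_pairs_eq
  by (simp add: genericity_def separation_def trope_invariant_def example_residuals chi_def
      conic_disc_def diag_disc_def pair_disc_def)

theorem theorem5p3:
  "\<exists>V. zariski_open_in U V \<and> V \<noteq> {} \<and>
     (\<forall>u\<in>V. \<exists>\<C>. card \<C> = 320 \<and> (\<forall>C\<in>\<C>. smooth_conic C \<and> C \<subseteq> heisenberg_quartic u))"
proof -
  define \<Phi> where "\<Phi> u = generic_coeffs (coeffs_of u)" for u
  define V where "V = U - proj_zeros {\<Phi>}"
  have "\<exists>d. form d \<Phi>" using form_generic_coeffs unfolding \<Phi>_def .
  then have "zariski_open_in U V"
    unfolding zariski_open_in_def zariski_closed_def V_def by (intro exI[of _ "proj_zeros {\<Phi>}"] conjI exI[of _ "{\<Phi>}"]) auto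
  moreover have "V \<noteq> {}"
  proof -
    define u :: "complex ^ 6" where "u = (\<chi> i. if i = 0 then -6 else if i = 1 then -2 else if i = 2 then -4
      else if i = 3 then 8 else if i = 4 then 1 else 3)"
    have u: "u $ 0 = -6" "u $ 1 = -2" "u $ 2 = -4" "u $ 3 = 8" "u $ 4 = 1" "u $ 5 = 3"
      by (simp_all add: u_def)
    then have "u \<noteq> 0" by auto
    have "coeffs_of u = Coeffs (-4) 12 16 (-8) (-4)" by (simp add: coeffs_of_def u)
    then have "\<Phi> u \<noteq> 0" using generic_coeffs_example by (simp add: \<Phi>_def)
    moreover have "u \<in> vec.span {u}" by (simp add: vec.span_base)
    ultimately have "vec.span {u} \<notin> proj_zeros {\<Phi>}" by (auto simp: proj_zeros_def)
    moreover have "vec.span {u} \<in> proj_space" using \<open>u \<noteq> 0\<close> by (auto simp: proj_space_def)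
    then have "vec.span {u} \<in> U"
      by (auto simp: U_def proj_zeros_def in_span_singleton u)
    ultimately show ?thesis by (auto simp: V_def)
  qed
  moreover have "\<exists>\<C>. card \<C> = 320 \<and> (\<forall>C\<in>\<C>. smooth_conic C \<and> C \<subseteq> heisenberg_quartic p)" if p: "p \<in> V" for p
  proof -
    have "p \<in> proj_space" "p \<notin> proj_zeros {\<Phi>}" using p by (auto simp: V_def U_def proj_zeros_def)
    then obtain u0 u where u0: "p = vec.span {u0}" and "u \<in> p" and \<Phi>: "\<Phi> u \<noteq> 0"
      by (auto simp: proj_space_def proj_zeros_def)
    obtain s where s: "u = s *s u0" using \<open>u \<in> p\<close> u0 by (auto simp: in_span_singleton)
    have "s \<noteq> 0"
    proof
      assume "s = 0"
      then have "segre (coeffs_of u) = 0" by (simp add: s coeffs_of_def segre_def)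
      then have "genericity 0 0 (coeffs_of u) = 0" by (simp add: genericity_def)
      moreover have "(0, 0) \<in> even_pairs" by (simp add: even_pairs_def chi_def)
      ultimately show False using \<Phi> unfolding \<Phi>_def generic_coeffs_nonzero_iff by fastforce
    qed
    obtain \<C> where card: "card \<C> = 320" and C: "\<And>C. C \<in> \<C> \<Longrightarrow> smooth_conic C \<and> (\<exists>a M. C = plane_conic a M \<and>
        (\<forall>v. dot a v = 0 \<longrightarrow> quad M v = 0 \<longrightarrow> quartic (coeffs_of u) v = 0))"
      using generic_quartic_contains_320_conics[OF \<Phi>[unfolded \<Phi>_def]] by metis
    have "C \<subseteq> heisenberg_quartic p" if "C \<in> \<C>" for C
    proof -
      obtain a M where CM: "C = plane_conic a M"
        and van: "\<And>v. dot a v = 0 \<Longrightarrow> quad M v = 0 \<Longrightarrow> quartic (coeffs_of u) v = 0"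
        using C[OF \<open>C \<in> \<C>\<close>] by blast
      have "heisenberg_form u' v = 0" if "u' \<in> p" "heisenberg_form u v = 0" for u' v
      proof -
        obtain s' where "u' = s' *s u0" using \<open>u' \<in> p\<close> u0 by (auto simp: in_span_singleton)
        then have "s * heisenberg_form u' v = s' * heisenberg_form u v"
          unfolding s by (simp add: heisenberg_form_def Let_def algebra_simps)
        with that(2) \<open>s \<noteq> 0\<close> show ?thesis by simp
      qed
      then show ?thesis using van
        unfolding CM plane_conic_def heisenberg_quartic_def proj_zeros_def heisenberg_form_eq by auto
    qed
    with card C show ?thesis by blast
  qed
  ultimately show ?thesis by blast
qed

end
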